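(* Let $p\ge 0$, $C\ge 1$, and let $(\kappa_i)_{i\ge1}$ satisfy $C^{-1}i^{-p}\le\kappa_i\le C i^{-p}$ for all $i\ge1$. Let $\alpha>0$ and let the prior on $f=(f_1,f_2,\dots)$ be $\Pi=\bigotimes_{i=1}^\infty N(0,\lambda_i)$ with $\lambda_i=i^{-1-2\alpha}$. Suppose the true $f_0$ belongs to $S^\beta$ for some $\beta>0$. Then for every $R>0$ and every sequence $M_n\to\infty$, $$\sup_{\|f_0\|_\beta\le R}\mathrm E_0\,\Pi\Bigl(f:\|f-f_0\|\ge M_n\,n^{-\frac{\alpha\wedge\beta}{1+2\alpha+2p}}\Bigm|Y^n\Bigr)\to 0\qquad (n\to\infty).$$
   Context: White noise sequence model: for $f\in\ell_2$ one observes $Y^n=(Y_1,Y_2,\dots)$ with $Y_i=\kappa_i f_i+n^{-1/2}Z_i$, where $Z_1,Z_2,\dots$ are independent standard normal and $(\kappa_i)$ is known. $\|\cdot\|$ is the $\ell_2$ norm. $S^\beta=\{f\in\ell_2:\|f\|_\beta^2:=\sum_i f_i^2 i^{2\beta}<\infty\}$. $N(0,\lambda)$ is the centered normal law with variance $\lambda$. $\Pi(\cdot\mid Y^n)$ is the posterior distribution of $f$ given $Y^n$, and $\mathrm E_0$ is expectation when $Y^n$ is generated with true parameter $f=f_0$. $a\wedge b=\min(a,b)$. *)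

theory Defs
  imports "HOL-Probability.Probability"
begin

text \<open>
  Sequences \<open>(x\<^sub>1, x\<^sub>2, \<dots>)\<close> are functions on \<^typ>\<open>nat\<close>, with \<open>x i\<close> standing for the entry of
  index \<open>i + 1\<close>; hence the weights \<open>real (Suc i)\<close> below. They live in the measurable space
  of all real sequences with the product \<open>\<sigma>\<close>-algebra.
\<close>

abbreviation seq_space :: "(nat \<Rightarrow> real) measure" where
  "seq_space \<equiv> \<Pi>\<^sub>M i\<in>UNIV. borel"

text \<open>The norms take the value \<open>\<infinity>\<close> when the defining series diverges.\<close>

definition l2_norm :: "(nat \<Rightarrow> real) \<Rightarrow> ennreal" where
  "l2_norm f = (if summable (\<lambda>i. (f i)\<^sup>2) then ennreal (sqrt (\<Sum>i. (f i)\<^sup>2)) else \<infinity>)"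

definition ell2 :: "(nat \<Rightarrow> real) set" where
  "ell2 = {f. l2_norm f < \<infinity>}"

definition sobolev_norm :: "real \<Rightarrow> (nat \<Rightarrow> real) \<Rightarrow> ennreal" where
  "sobolev_norm \<beta> f =
     (if summable (\<lambda>i. (f i)\<^sup>2 * real (Suc i) powr (2 * \<beta>))
      then ennreal (sqrt (\<Sum>i. (f i)\<^sup>2 * real (Suc i) powr (2 * \<beta>))) else \<infinity>)"

definition sobolev_space :: "real \<Rightarrow> (nat \<Rightarrow> real) set" where
  "sobolev_space \<beta> = {f \<in> ell2. sobolev_norm \<beta> f < \<infinity>}"

text \<open>\<^const>\<open>normal_density\<close> is parametrised by the standard deviation, \<open>N(0, v)\<close> by the variance.\<close>

definition centered_normal :: "real \<Rightarrow> real measure" where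
  "centered_normal v = density lborel (\<lambda>x. ennreal (normal_density 0 (sqrt v) x))"

definition gaussian_prior :: "(nat \<Rightarrow> real) \<Rightarrow> (nat \<Rightarrow> real) measure" where
  "gaussian_prior v = (\<Pi>\<^sub>M i\<in>UNIV. centered_normal (v i))"

definition white_noise :: "(nat \<Rightarrow> real) measure" where
  "white_noise = (\<Pi>\<^sub>M i\<in>UNIV. std_normal_distribution)"

definition observe :: "(nat \<Rightarrow> real) \<Rightarrow> nat \<Rightarrow> (nat \<Rightarrow> real) \<Rightarrow> (nat \<Rightarrow> real) \<Rightarrow> nat \<Rightarrow> real" where
  "observe \<kappa> n f z = (\<lambda>i. \<kappa> i * f i + real n powr (-1/2) * z i)"

text \<open>The law of \<open>Y\<^sup>n\<close> when the parameter is \<open>f\<close>.\<close>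

definition obs_law :: "(nat \<Rightarrow> real) \<Rightarrow> nat \<Rightarrow> (nat \<Rightarrow> real) \<Rightarrow> (nat \<Rightarrow> real) measure" where
  "obs_law \<kappa> n f = distr white_noise seq_space (observe \<kappa> n f)"

text \<open>
  The joint law of \<open>(f, Y\<^sup>n)\<close> in the Bayesian model, where \<open>f\<close> has the prior law and is
  independent of the noise.
\<close>

definition bayes_joint ::
  "(nat \<Rightarrow> real) measure \<Rightarrow> (nat \<Rightarrow> real) \<Rightarrow> nat \<Rightarrow> ((nat \<Rightarrow> real) \<times> (nat \<Rightarrow> real)) measure" where
  "bayes_joint prior \<kappa> n =
     distr (prior \<Otimes>\<^sub>M white_noise) (seq_space \<Otimes>\<^sub>M seq_space) (\<lambda>(f, z). (f, observe \<kappa> n f z))"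

text \<open>
  A posterior distribution is a regular version of the conditional law of \<open>f\<close> given \<open>Y\<^sup>n\<close>: a
  Markov kernel that disintegrates the joint law over its second marginal. It is determined
  only up to null sets of that marginal, hence a predicate and not a function.
\<close>

definition is_posterior ::
  "(nat \<Rightarrow> real) measure \<Rightarrow> (nat \<Rightarrow> real) \<Rightarrow> nat \<Rightarrow> ((nat \<Rightarrow> real) \<Rightarrow> (nat \<Rightarrow> real) measure) \<Rightarrow> bool"
where
  "is_posterior prior \<kappa> n K \<longleftrightarrow>
     K \<in> seq_space \<rightarrow>\<^sub>M prob_algebra seq_space \<and>
     (\<forall>A\<in>sets seq_space. \<forall>B\<in>sets seq_space.
        emeasure (bayes_joint prior \<kappa> n) (A \<times> B) =
        (\<integral>\<^sup>+y\<in>B. emeasure (K y) A \<partial>distr (bayes_joint prior \<kappa> n) seq_space snd))"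

end

theory Submission
  imports Defs
begin

text \<open>
  The coordinates decouple: given \<open>Y\<^sup>n\<close>, the \<open>i\<close>-th coordinate of the parameter is normal with
  mean \<open>n \<lambda>\<^sub>i \<kappa>\<^sub>i Y\<^sub>i / D\<^sub>i\<close> and variance \<open>\<lambda>\<^sub>i / D\<^sub>i\<close>, where \<open>D\<^sub>i = 1 + n \<lambda>\<^sub>i \<kappa>\<^sub>i\<^sup>2\<close>. When the data
  come from \<open>f0\<close>, the expected posterior second moment about \<open>f0\<close> is therefore at most
  \<open>\<Sum>\<^sub>i f0\<^sub>i\<^sup>2 / D\<^sub>i\<^sup>2 + 2 \<Sum>\<^sub>i \<lambda>\<^sub>i / D\<^sub>i\<close> (\<open>frequentist_post_risk\<close>): a squared bias, and the spread of the
  posterior together with the variance of its mean. Since \<open>D\<^sub>i\<close> is of order \<open>1 + n i\<^sup>-\<^sup>q\<close> with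
  \<open>q = 1 + 2\<alpha> + 2p\<close>, the data inform about the coordinates up to \<open>n\<^sup>1\<^sup>/\<^sup>q\<close>. Up to this cutoff the
  \<open>i\<close>-th variance is of order \<open>i\<^sup>2\<^sup>p / n\<close>, beyond it the prior variances and the coefficients of \<open>f0\<close>
  remain. In total this gives the square of the claimed rate, uniformly over the Sobolev ball
  (\<open>total_risk_sum\<close>). Markov's inequality then bounds the posterior mass outside the ball of radius \<open>M\<^sub>n\<close> times the rate by a constant over \<open>M\<^sub>n\<^sup>2\<close>.

  Two points need care because a posterior is only some disintegration of the joint law. First, its
  coordinatewise second moments have to be identified: they are conditional expectations, and
  testing on cylinder sets reduces them to the one-dimensional conjugacy computation
  (\<open>posterior_second_moment\<close>). This identity holds up to null sets of the marginal law of the data,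
  while the theorem integrates over the data law of one fixed parameter. Hence, secondly, the latter
  has to be absolutely continuous with respect to the former (\<open>obs_law_null\<close>). That follows from
  the invariance of the null sets of white noise under square-summable shifts
  (\<open>white_noise_shift_null\<close>), which rests on a second-moment bound for likelihood ratios of finitely
  many coordinates, Fatou's lemma on open sets, and outer regularity of measures on the Polish space
  of sequences.
\<close>

section \<open>Integrals over infinite products\<close>

text \<open>
  A function of finitely many coordinates only sees a finite product measure, where Tonelli's
  theorem splits it.
\<close>

lemma nn_integral_PiM_prod:
  fixes M :: "'i \<Rightarrow> 'a measure"
  assumes M: "\<And>i. prob_space (M i)" and J: "finite J"
    and [measurable]: "\<And>j. j \<in> J \<Longrightarrow> \<psi> j \<in> borel_measurable (M j)"
  shows "(\<integral>\<^sup>+x. (\<Prod>j\<in>J. \<psi> j (x j)) \<partial>PiM UNIV M) = (\<Prod>j\<in>J. \<integral>\<^sup>+t. \<psi> j t \<partial>M j)"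
proof -
  interpret product_prob_space M UNIV
    by (rule product_prob_spaceI) (rule M)
  have "(\<integral>\<^sup>+x. (\<Prod>j\<in>J. \<psi> j (x j)) \<partial>PiM UNIV M)
      = (\<integral>\<^sup>+x. (\<Prod>j\<in>J. \<psi> j (restrict x J j)) \<partial>PiM UNIV M)"
    by (intro nn_integral_cong prod.cong) auto
  also have "\<dots> = (\<integral>\<^sup>+x. (\<Prod>j\<in>J. \<psi> j (x j)) \<partial>distr (PiM UNIV M) (PiM J M) (\<lambda>x. restrict x J))"
    by (subst nn_integral_distr) (auto intro!: borel_measurable_prod)
  also have "\<dots> = (\<Prod>j\<in>J. \<integral>\<^sup>+t. \<psi> j t \<partial>M j)"
    using J by (simp add: distr_PiM_restrict_finite product_nn_integral_prod)
  finally show ?thesis .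
qed

lemma sets_PiM_real:
  assumes "\<And>i. sets (M i) = sets (borel :: real measure)"
  shows "sets (PiM UNIV M) = sets seq_space"
  using assms by (intro sets_PiM_cong) auto

text \<open>
  In the model the coordinate pairs \<open>(f\<^sub>j, z\<^sub>j)\<close> are independent. Keeping prior and noise as two
  separate products, this is the form in which that independence is used, for events that depend
  on the \<open>j\<close>-th pair through \<open>\<kappa>\<^sub>j f\<^sub>j + n\<^sup>-\<^sup>1\<^sup>/\<^sup>2 z\<^sub>j\<close>.
\<close>

lemma nn_integral_PiM_PiM_prod:
  fixes M N :: "nat \<Rightarrow> real measure"
  assumes M: "\<And>i. prob_space (M i)" "\<And>i. sets (M i) = sets borel"
    and N: "\<And>i. prob_space (N i)" "\<And>i. sets (N i) = sets borel"
    and J: "finite J"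
    and \<phi>: "\<And>j. j \<in> J \<Longrightarrow> case_prod (\<phi> j) \<in> borel_measurable (borel \<Otimes>\<^sub>M borel)"
  shows "(\<integral>\<^sup>+x. \<integral>\<^sup>+y. (\<Prod>j\<in>J. \<phi> j (x j) (y j)) \<partial>PiM UNIV N \<partial>PiM UNIV M)
       = (\<Prod>j\<in>J. \<integral>\<^sup>+s. \<integral>\<^sup>+t. \<phi> j s t \<partial>N j \<partial>M j)"
proof -
  have N': "sigma_finite_measure (N j)" for j
    using N(1) by (rule prob_space_imp_sigma_finite)
  have m1: "\<phi> j s \<in> borel_measurable (N j)" if "j \<in> J" for j s
  proof -
    note \<phi>[OF that, measurable]
    have "(\<lambda>t. case_prod (\<phi> j) (s, t)) \<in> borel_measurable borel" by measurable
    then show ?thesis by (simp add: N(2) cong: measurable_cong_sets)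
  qed
  have m2: "(\<lambda>s. \<integral>\<^sup>+t. \<phi> j s t \<partial>N j) \<in> borel_measurable (M j)" if "j \<in> J" for j
  proof -
    have "sets (M j \<Otimes>\<^sub>M N j) = sets (borel \<Otimes>\<^sub>M borel)"
      by (rule sets_pair_measure_cong) (auto simp: M N)
    then have "case_prod (\<phi> j) \<in> borel_measurable (M j \<Otimes>\<^sub>M N j)"
      using \<phi>[OF that] by (simp cong: measurable_cong_sets)
    from sigma_finite_measure.borel_measurable_nn_integral_fst[OF N' this]
    show ?thesis by simp
  qed
  have "(\<integral>\<^sup>+y. (\<Prod>j\<in>J. \<phi> j (x j) (y j)) \<partial>PiM UNIV N) = (\<Prod>j\<in>J. \<integral>\<^sup>+t. \<phi> j (x j) t \<partial>N j)" for x
    by (rule nn_integral_PiM_prod[where M = N and \<psi> = "\<lambda>j. \<phi> j (x j)", OF N(1) J m1])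
  then show ?thesis
    using nn_integral_PiM_prod[where M = M and \<psi> = "\<lambda>j s. \<integral>\<^sup>+t. \<phi> j s t \<partial>N j", OF M(1) J m2] by simp
qed

section \<open>Gaussian conjugacy in one coordinate\<close>

text \<open>
  The two factorisations of the joint density of \<open>(f, y)\<close> when \<open>f \<sim> N(0, l)\<close> and, given \<open>f\<close>,
  \<open>y \<sim> N(k f, \<epsilon>\<^sup>2)\<close>: as prior times likelihood, and as marginal of \<open>y\<close> times posterior of \<open>f\<close>.
  Completing the square in \<open>f\<close> turns one into the other.
\<close>

lemma normal_density_conjugacy:
  fixes l \<epsilon> k f y :: real
  assumes l: "l > 0" and e: "\<epsilon> > 0"
  defines "v \<equiv> k\<^sup>2 * l + \<epsilon>\<^sup>2"
  shows "normal_density 0 (sqrt l) f * normal_density (k * f) \<epsilon> y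
       = normal_density 0 (sqrt v) y * normal_density (l * k / v * y) (sqrt (l * \<epsilon>\<^sup>2 / v)) f"
proof -
  have v: "v > 0" unfolding v_def using l e by (simp add: add_nonneg_pos)
  have ex: "- (f\<^sup>2 / (2 * l)) + - ((y - k * f)\<^sup>2 / (2 * \<epsilon>\<^sup>2))
      = - (y\<^sup>2 / (2 * v)) + - ((f - l * k / v * y)\<^sup>2 / (2 * (l * \<epsilon>\<^sup>2 / v)))"
  proof -
    have "(f - l * k / v * y)\<^sup>2 / (2 * (l * \<epsilon>\<^sup>2 / v)) = (v * f - l * k * y)\<^sup>2 / (2 * l * \<epsilon>\<^sup>2 * v)"
      using v l e by (simp add: power2_eq_square field_simps)
    moreover have "f\<^sup>2 / (2 * l) + (y - k * f)\<^sup>2 / (2 * \<epsilon>\<^sup>2) 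
       = (\<epsilon>\<^sup>2 * v * f\<^sup>2 + l * v * (y - k * f)\<^sup>2) / (2 * l * \<epsilon>\<^sup>2 * v)"
      using v l e by (simp add: power2_eq_square field_simps)
    moreover have "y\<^sup>2 / (2 * v) = (y\<^sup>2 * l * \<epsilon>\<^sup>2) / (2 * l * \<epsilon>\<^sup>2 * v)"
      using v l e by (simp add: power2_eq_square field_simps)
    moreover have "\<epsilon>\<^sup>2 * v * f\<^sup>2 + l * v * (y - k * f)\<^sup>2 = y\<^sup>2 * l * \<epsilon>\<^sup>2 + (v * f - l * k * y)\<^sup>2"
      unfolding v_def by (simp add: power2_eq_square algebra_simps)
    ultimately show ?thesis by (simp add: add_divide_distrib)
  qed
  have c: "sqrt (2 * pi * l) * sqrt (2 * pi * \<epsilon>\<^sup>2)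
     = sqrt (2 * pi * v) * sqrt (2 * pi * (l * \<epsilon>\<^sup>2 / v))"
    using v l e by (simp add: real_sqrt_mult[symmetric])
  have "normal_density 0 (sqrt l) f * normal_density (k * f) \<epsilon> y
     = 1 / (sqrt (2 * pi * l) * sqrt (2 * pi * \<epsilon>\<^sup>2)) *
       exp (- (f\<^sup>2 / (2 * l)) + - ((y - k * f)\<^sup>2 / (2 * \<epsilon>\<^sup>2)))"
    using l e by (simp only: exp_add) (simp add: normal_density_def)
  also have "\<dots> = normal_density 0 (sqrt v) y * normal_density (l * k / v * y) (sqrt (l * \<epsilon>\<^sup>2 / v)) f"
    unfolding ex c exp_add using v l e by (simp add: normal_density_def)
  finally show ?thesis .
qed

text \<open>
  Bias-variance decomposition about the point \<open>a\<close>.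
\<close>

lemma normal_second_moment:
  fixes \<mu> \<sigma> a :: real
  assumes s: "\<sigma> > 0"
  shows "(\<integral>\<^sup>+x. ennreal ((x - a)\<^sup>2) * ennreal (normal_density \<mu> \<sigma> x) \<partial>lborel) = ennreal ((\<mu> - a)\<^sup>2 + \<sigma>\<^sup>2)"
proof -
  have 2: "has_bochner_integral lborel (\<lambda>x. normal_density \<mu> \<sigma> x * (x - \<mu>)\<^sup>2) (\<sigma>\<^sup>2)"
    using normal_moment_even[OF s, of \<mu> 1] s by simp
  have 1: "has_bochner_integral lborel (\<lambda>x. normal_density \<mu> \<sigma> x * (x - \<mu>)) 0"
    using normal_moment_odd[OF s, of \<mu> 0] by simp
  have 0: "has_bochner_integral lborel (normal_density \<mu> \<sigma>) 1"
    using normal_moment_even[OF s, of \<mu> 0] by simp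
  have "has_bochner_integral lborel (\<lambda>x. normal_density \<mu> \<sigma> x * (x - \<mu>)\<^sup>2
     + (normal_density \<mu> \<sigma> x * (x - \<mu>) * (2 * (\<mu> - a)) + normal_density \<mu> \<sigma> x * (\<mu> - a)\<^sup>2))
      (\<sigma>\<^sup>2 + (0 * (2 * (\<mu> - a)) + 1 * (\<mu> - a)\<^sup>2))"
    by (intro has_bochner_integral_add has_bochner_integral_mult_left 0 1 2)
  also have "(\<lambda>x. normal_density \<mu> \<sigma> x * (x - \<mu>)\<^sup>2
     + (normal_density \<mu> \<sigma> x * (x - \<mu>) * (2 * (\<mu> - a)) + normal_density \<mu> \<sigma> x * (\<mu> - a)\<^sup>2))
     = (\<lambda>x. (x - a)\<^sup>2 * normal_density \<mu> \<sigma> x)"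
    by (rule ext) (simp add: power2_eq_square algebra_simps)
  finally have B: "has_bochner_integral lborel (\<lambda>x. (x - a)\<^sup>2 * normal_density \<mu> \<sigma> x) ((\<mu> - a)\<^sup>2 + \<sigma>\<^sup>2)"
    by (simp add: add.commute)
  show ?thesis
    using nn_integral_eq_integral[OF has_bochner_integral_iff[THEN iffD1, OF B, THEN conjunct1]]
       has_bochner_integral_integral_eq[OF B]
    by (simp add: ennreal_mult')
qed

text \<open>
  Bayes' formula in integrated form: the right-hand side integrates first over the posterior of
  \<open>f\<close> given \<open>y\<close> and then over the marginal law of \<open>y\<close>.
\<close>

lemma nn_integral_normal_pair:
  fixes l \<epsilon> k :: real and H :: "real \<Rightarrow> real \<Rightarrow> ennreal"
  assumes l: "l > 0" and e: "\<epsilon> > 0"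
    and [measurable]: "case_prod H \<in> borel_measurable (borel \<Otimes>\<^sub>M borel)"
  defines "v \<equiv> k\<^sup>2 * l + \<epsilon>\<^sup>2"
  shows "(\<integral>\<^sup>+f. \<integral>\<^sup>+z. H f (k * f + \<epsilon> * z) \<partial>std_normal_distribution \<partial>centered_normal l)
    = (\<integral>\<^sup>+y. normal_density 0 (sqrt v) y *
         (\<integral>\<^sup>+f. H f y * normal_density (l * k / v * y) (sqrt (l * \<epsilon>\<^sup>2 / v)) f \<partial>lborel) \<partial>lborel)"
proof -
  have inner: "(\<integral>\<^sup>+z. H f (k * f + \<epsilon> * z) \<partial>std_normal_distribution)
     = (\<integral>\<^sup>+y. H f y * normal_density (k * f) \<epsilon> y \<partial>lborel)" for f
  proof -
    have "ennreal \<epsilon> * ennreal (normal_density (k * f) \<epsilon> (k * f + \<epsilon> * z)) = std_normal_density z" for z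
      using e by (simp add: normal_density_def ennreal_mult'[symmetric] real_sqrt_mult power_mult_distrib)
    then have *: "ennreal \<epsilon> * (H f (k * f + \<epsilon> * z) * ennreal (normal_density (k * f) \<epsilon> (k * f + \<epsilon> * z)))
        = std_normal_density z * H f (k * f + \<epsilon> * z)" for z
      by (metis mult.left_commute mult.commute)
    have "(\<integral>\<^sup>+y. H f y * normal_density (k * f) \<epsilon> y \<partial>lborel)
       = ennreal \<bar>\<epsilon>\<bar> * (\<integral>\<^sup>+z. H f (k * f + \<epsilon> * z) * normal_density (k * f) \<epsilon> (k * f + \<epsilon> * z) \<partial>lborel)"
      using e by (intro nn_integral_real_affine) auto
    also have "\<dots> = (\<integral>\<^sup>+z. std_normal_density z * H f (k * f + \<epsilon> * z) \<partial>lborel)"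
      using e by (simp add: nn_integral_cmult[symmetric] *)
    also have "\<dots> = (\<integral>\<^sup>+z. H f (k * f + \<epsilon> * z) \<partial>std_normal_distribution)"
      by (subst nn_integral_density) auto
    finally show ?thesis by simp
  qed
  have "(\<integral>\<^sup>+f. \<integral>\<^sup>+z. H f (k * f + \<epsilon> * z) \<partial>std_normal_distribution \<partial>centered_normal l)
     = (\<integral>\<^sup>+f. \<integral>\<^sup>+y. normal_density 0 (sqrt l) f * (H f y * normal_density (k * f) \<epsilon> y) \<partial>lborel \<partial>lborel)"
    unfolding inner centered_normal_def
    by (subst nn_integral_density) (auto simp: nn_integral_cmult normal_density_def)
  also have "\<dots> = (\<integral>\<^sup>+y. \<integral>\<^sup>+f. normal_density 0 (sqrt l) f * (H f y * normal_density (k * f) \<epsilon> y) \<partial>lborel \<partial>lborel)"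
    by (rule lborel_pair.Fubini') (simp add: normal_density_def)
  also have "\<dots> = (\<integral>\<^sup>+y. \<integral>\<^sup>+f. normal_density 0 (sqrt v) y *
      (H f y * normal_density (l * k / v * y) (sqrt (l * \<epsilon>\<^sup>2 / v)) f) \<partial>lborel \<partial>lborel)"
  proof (intro nn_integral_cong)
    fix y f
    have "ennreal (normal_density 0 (sqrt l) f) * ennreal (normal_density (k * f) \<epsilon> y)
      = ennreal (normal_density 0 (sqrt v) y) * ennreal (normal_density (l * k / v * y) (sqrt (l * \<epsilon>\<^sup>2 / v)) f)"
      using normal_density_conjugacy[OF l e, of f k y] unfolding v_def
      by (simp add: ennreal_mult'[symmetric])
    then show "normal_density 0 (sqrt l) f * (H f y * normal_density (k * f) \<epsilon> y)
      = normal_density 0 (sqrt v) y *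
      (H f y * normal_density (l * k / v * y) (sqrt (l * \<epsilon>\<^sup>2 / v)) f)"
      by (metis mult.left_commute mult.commute)
  qed
  also have "\<dots> = (\<integral>\<^sup>+y. normal_density 0 (sqrt v) y *
         (\<integral>\<^sup>+f. H f y * normal_density (l * k / v * y) (sqrt (l * \<epsilon>\<^sup>2 / v)) f \<partial>lborel) \<partial>lborel)"
    by (intro nn_integral_cong nn_integral_cmult) (simp add: normal_density_def)
  finally show ?thesis .
qed

text \<open>
  The second moment about \<open>a\<close> of the posterior \<open>N(l k y / v, l \<epsilon>\<^sup>2 / v)\<close>, where
  \<open>v = k\<^sup>2 l + \<epsilon>\<^sup>2\<close> is the marginal variance of \<open>y\<close>.
\<close>

definition post_risk :: "real \<Rightarrow> real \<Rightarrow> real \<Rightarrow> real \<Rightarrow> real \<Rightarrow> real" where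
  "post_risk l k \<epsilon> a y = (l * k / (k\<^sup>2 * l + \<epsilon>\<^sup>2) * y - a)\<^sup>2 + l * \<epsilon>\<^sup>2 / (k\<^sup>2 * l + \<epsilon>\<^sup>2)"

lemma post_risk_measurable [measurable]: "post_risk l k \<epsilon> a \<in> borel_measurable borel"
  unfolding post_risk_def by measurable

text \<open>
  This says that \<^const>\<open>post_risk\<close> at \<open>y\<close> is the conditional expectation of \<open>(f - a)\<^sup>2\<close> given \<open>y\<close>,
  tested against arbitrary nonnegative functions \<open>\<psi>\<close> of \<open>y\<close>.
\<close>

lemma post_risk_conditional_expectation:
  fixes l \<epsilon> k a :: real and \<psi> :: "real \<Rightarrow> ennreal"
  assumes l: "l > 0" and e: "\<epsilon> > 0" and [measurable]: "\<psi> \<in> borel_measurable borel"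
  shows "(\<integral>\<^sup>+f. \<integral>\<^sup>+z. ennreal ((f - a)\<^sup>2) * \<psi> (k * f + \<epsilon> * z) \<partial>std_normal_distribution \<partial>centered_normal l)
    = (\<integral>\<^sup>+f. \<integral>\<^sup>+z. ennreal (post_risk l k \<epsilon> a (k * f + \<epsilon> * z)) * \<psi> (k * f + \<epsilon> * z)
         \<partial>std_normal_distribution \<partial>centered_normal l)"
proof -
  define v where "v = k\<^sup>2 * l + \<epsilon>\<^sup>2"
  have v: "v > 0" unfolding v_def using l e by (simp add: add_nonneg_pos)
  define s where "s = sqrt (l * \<epsilon>\<^sup>2 / v)"
  have s: "s > 0" "s\<^sup>2 = l * \<epsilon>\<^sup>2 / v" using v l e by (simp_all add: s_def)
  have 1: "(\<integral>\<^sup>+f. ennreal ((f - a)\<^sup>2) * \<psi> y * normal_density (l * k / v * y) s f \<partial>lborel)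
     = ennreal (post_risk l k \<epsilon> a y) * \<psi> y" for y
  proof -
    have "(\<integral>\<^sup>+f. ennreal ((f - a)\<^sup>2) * \<psi> y * normal_density (l * k / v * y) s f \<partial>lborel)
      = (\<integral>\<^sup>+f. \<psi> y * (ennreal ((f - a)\<^sup>2) * normal_density (l * k / v * y) s f) \<partial>lborel)"
      by (simp add: mult_ac)
    also have "\<dots> = \<psi> y * ennreal ((l * k / v * y - a)\<^sup>2 + s\<^sup>2)"
      by (subst nn_integral_cmult) (auto simp: normal_second_moment[OF s(1)])
    finally show ?thesis by (simp add: s(2) post_risk_def v_def mult.commute)
  qed
  have 2: "(\<integral>\<^sup>+f. ennreal (post_risk l k \<epsilon> a y) * \<psi> y * normal_density (l * k / v * y) s f \<partial>lborel)
     = ennreal (post_risk l k \<epsilon> a y) * \<psi> y" for y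
    by (subst nn_integral_cmult)
       (auto simp: nn_integral_eq_integral integrable_normal_density[OF s(1)] integral_normal_density[OF s(1)])
  have "(\<integral>\<^sup>+f. \<integral>\<^sup>+z. ennreal ((f - a)\<^sup>2) * \<psi> (k * f + \<epsilon> * z) \<partial>std_normal_distribution \<partial>centered_normal l)
    = (\<integral>\<^sup>+y. normal_density 0 (sqrt v) y * (ennreal (post_risk l k \<epsilon> a y) * \<psi> y) \<partial>lborel)"
    using nn_integral_normal_pair[OF l e, of "\<lambda>f y. ennreal ((f - a)\<^sup>2) * \<psi> y" k]
    unfolding v_def[symmetric] s_def[symmetric] 1 by simp
  also have "\<dots> = (\<integral>\<^sup>+f. \<integral>\<^sup>+z. ennreal (post_risk l k \<epsilon> a (k * f + \<epsilon> * z)) * \<psi> (k * f + \<epsilon> * z)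
         \<partial>std_normal_distribution \<partial>centered_normal l)"
    using nn_integral_normal_pair[OF l e, of "\<lambda>f y. ennreal (post_risk l k \<epsilon> a y) * \<psi> y" k]
    unfolding v_def[symmetric] s_def[symmetric] 2 by simp
  finally show ?thesis .
qed

section \<open>Shifting white noise by a square-summable sequence\<close>

lemma prob_space_centered_normal: "v > 0 \<Longrightarrow> prob_space (centered_normal v)"
  unfolding centered_normal_def by (rule prob_space_normal_density) simp

lemma sets_centered_normal: "sets (centered_normal v) = sets borel"
  by (simp add: centered_normal_def)

lemma prob_space_std_normal: "prob_space std_normal_distribution"
  by (rule prob_space_normal_density) simp

lemma sets_white_noise [measurable_cong]: "sets white_noise = sets seq_space"
  unfolding white_noise_def by (rule sets_PiM_real) simp

lemma prob_space_white_noise: "prob_space white_noise"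
  unfolding white_noise_def by (intro prob_space_PiM prob_space_std_normal)

lemma indicator_cylinder:
  assumes "finite J"
  shows "(indicator (prod_emb UNIV (\<lambda>_. borel) J (Pi\<^sub>E J A)) x :: ennreal)
     = (\<Prod>j\<in>J. indicator (A j) (x j :: real))"
proof (cases "\<forall>j\<in>J. x j \<in> A j")
  case True
  then show ?thesis by (auto simp: prod_emb_def indicator_def)
next
  case False
  then obtain j where "j \<in> J" "x j \<notin> A j" by blast
  then have "(\<Prod>j\<in>J. indicator (A j) (x j) :: ennreal) = 0"
    using assms by (intro prod_zero bexI[of _ j]) (auto simp: indicator_def)
  then show ?thesis using False by (auto simp: prod_emb_def indicator_def)
qed

text \<open>
  The factor is the likelihood ratio of \<open>N(h, 1)\<close> to \<open>N(0, 1)\<close>.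
\<close>

lemma std_normal_shift:
  fixes h :: real
  assumes [measurable]: "G \<in> borel_measurable borel"
  shows "(\<integral>\<^sup>+z. G (z + h) \<partial>std_normal_distribution)
       = (\<integral>\<^sup>+z. ennreal (exp (h * z - h\<^sup>2 / 2)) * G z \<partial>std_normal_distribution)"
proof -
  have *: "ennreal (std_normal_density (- h + x)) = ennreal (std_normal_density x) * ennreal (exp (h * x - h\<^sup>2 / 2))" for x
  proof -
    have e: "- (- h + x)\<^sup>2 / 2 = - x\<^sup>2 / 2 + (h * x - h\<^sup>2 / 2)"
      by (simp add: power2_eq_square field_simps)
    show ?thesis
      unfolding std_normal_density_def e exp_add by (simp add: ennreal_mult'[symmetric])
  qed
  have "(\<integral>\<^sup>+z. G (z + h) \<partial>std_normal_distribution)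
      = (\<integral>\<^sup>+z. std_normal_density z * G (z + h) \<partial>lborel)"
    by (subst nn_integral_density) auto
  also have "\<dots> = ennreal \<bar>1\<bar> * (\<integral>\<^sup>+x. std_normal_density (- h + 1 * x) * G (- h + 1 * x + h) \<partial>lborel)"
    by (rule nn_integral_real_affine) auto
  also have "\<dots> = (\<integral>\<^sup>+z. ennreal (exp (h * z - h\<^sup>2 / 2)) * G z \<partial>std_normal_distribution)"
    by (subst nn_integral_density) (simp_all only: *, auto simp: mult_ac)
  finally show ?thesis .
qed

lemma std_normal_exp_square:
  fixes h :: real
  shows "(\<integral>\<^sup>+z. ennreal (exp (h * z - h\<^sup>2 / 2)) ^ 2 \<partial>std_normal_distribution) = ennreal (exp (h\<^sup>2))"
proof -
  interpret prob_space std_normal_distribution by (rule prob_space_std_normal)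
  have "(\<integral>\<^sup>+z. ennreal (exp (h * z - h\<^sup>2 / 2)) * 1 \<partial>std_normal_distribution) = 1"
    by (subst std_normal_shift[symmetric]) (simp_all add: emeasure_space_1[simplified])
  moreover have "(\<integral>\<^sup>+z. ennreal (exp (h * z - h\<^sup>2 / 2)) ^ 2 \<partial>std_normal_distribution)
      = (\<integral>\<^sup>+z. ennreal (exp (h * (z + h) - h\<^sup>2 / 2)) \<partial>std_normal_distribution)"
    by (subst std_normal_shift) (simp_all add: power2_eq_square)
  moreover have "ennreal (exp (h * (z + h) - h\<^sup>2 / 2)) = ennreal (exp (h\<^sup>2)) * ennreal (exp (h * z - h\<^sup>2 / 2))" for z
    by (simp add: ennreal_mult'[symmetric] exp_add[symmetric] power2_eq_square algebra_simps)
  ultimately show ?thesis by (simp add: nn_integral_cmult)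
qed

definition truncation :: "nat \<Rightarrow> (nat \<Rightarrow> real) \<Rightarrow> nat \<Rightarrow> real" where
  "truncation N h = (\<lambda>i. if i < N then h i else 0)"

text \<open>
  The likelihood ratio of white noise shifted by the truncation of \<open>h\<close> to unshifted white noise.
\<close>

definition tilt :: "nat \<Rightarrow> (nat \<Rightarrow> real) \<Rightarrow> (nat \<Rightarrow> real) \<Rightarrow> ennreal" where
  "tilt N h z = (\<Prod>i<N. ennreal (exp (h i * z i - (h i)\<^sup>2 / 2)))"

lemma measurable_tilt [measurable]: "tilt N h \<in> borel_measurable seq_space"
  unfolding tilt_def by measurable

lemma measurable_shift [measurable]: "(\<lambda>z i. z i + h i) \<in> seq_space \<rightarrow>\<^sub>M seq_space"
  for h :: "nat \<Rightarrow> real"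
  by (rule measurable_PiM_single') auto

lemma white_noise_truncated_shift:
  "distr white_noise seq_space (\<lambda>z i. z i + truncation N h i) = density white_noise (tilt N h)"
proof (rule measure_eqI_PiM_infinite)
  fix A :: "nat \<Rightarrow> real set" and J :: "nat set"
  assume J: "finite J" and A: "\<And>i. i \<in> J \<Longrightarrow> A i \<in> sets borel"
  define K where "K = J \<union> {..<N}"
  define A' where "A' j = (if j \<in> J then A j else UNIV)" for j
  have [measurable]: "A' j \<in> sets borel" for j using A by (auto simp: A'_def)
  have K: "finite K" using J by (simp add: K_def)
  let ?B = "prod_emb UNIV (\<lambda>_. borel) J (Pi\<^sub>E J A)"
  let ?e = "\<lambda>j t. ennreal (exp (truncation N h j * t - (truncation N h j)\<^sup>2 / 2))"
  have B [measurable]: "?B \<in> sets seq_space"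
    using J A by (intro sets_PiM_I) auto
  have ind: "indicator ?B x = (\<Prod>j\<in>K. indicator (A' j) (x j) :: ennreal)" for x
    unfolding indicator_cylinder[OF J] using K
    by (intro prod.mono_neutral_cong_left) (auto simp: K_def A'_def)
  have tilt: "tilt N h x = (\<Prod>j\<in>K. ?e j (x j))" for x
    unfolding tilt_def using K
    by (intro prod.mono_neutral_cong_left) (auto simp: K_def truncation_def)
  have "emeasure (distr white_noise seq_space (\<lambda>z i. z i + truncation N h i)) ?B
     = (\<integral>\<^sup>+z. indicator ?B z \<partial>distr white_noise seq_space (\<lambda>z i. z i + truncation N h i))"
    by simp
  also have "\<dots> = (\<integral>\<^sup>+z. indicator ?B (\<lambda>i. z i + truncation N h i) \<partial>white_noise)"
    by (subst nn_integral_distr) auto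
  also have "\<dots> = (\<Prod>j\<in>K. \<integral>\<^sup>+z. indicator (A' j) (z + truncation N h j) \<partial>std_normal_distribution)"
    unfolding ind white_noise_def
    using nn_integral_PiM_prod[where M = "\<lambda>_. std_normal_distribution" and J = K
        and \<psi> = "\<lambda>j t. indicator (A' j) (t + truncation N h j)", OF prob_space_std_normal K] by simp
  also have "\<dots> = (\<Prod>j\<in>K. \<integral>\<^sup>+z. ?e j z * indicator (A' j) z \<partial>std_normal_distribution)"
    by (intro prod.cong refl std_normal_shift) simp
  also have "\<dots> = (\<integral>\<^sup>+z. (\<Prod>j\<in>K. ?e j (z j) * indicator (A' j) (z j)) \<partial>white_noise)"
    unfolding white_noise_def
    using nn_integral_PiM_prod[where M = "\<lambda>_. std_normal_distribution" and J = K
        and \<psi> = "\<lambda>j t. ?e j t * indicator (A' j) t", OF prob_space_std_normal K] by simp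
  also have "\<dots> = (\<integral>\<^sup>+z. tilt N h z * indicator ?B z \<partial>white_noise)"
    unfolding ind tilt prod.distrib ..
  also have "\<dots> = emeasure (density white_noise (tilt N h)) ?B"
    by (subst emeasure_density) auto
  finally show "emeasure (distr white_noise seq_space (\<lambda>z i. z i + truncation N h i)) ?B
     = emeasure (density white_noise (tilt N h)) ?B" .
next
  interpret prob_space white_noise by (rule prob_space_white_noise)
  show "finite_measure (distr white_noise seq_space (\<lambda>z i. z i + truncation N h i))"
    by (rule finite_measure_distr) measurable
qed (simp_all add: sets_white_noise)

text \<open>
  For square-summable \<open>h\<close> the second moments of the likelihood ratios stay bounded in \<open>N\<close>. This
  uniform integrability lets absolute continuity survive the passage to the limit.
\<close>

lemma nn_integral_tilt_square:
  "(\<integral>\<^sup>+z. (tilt N h z)\<^sup>2 \<partial>white_noise) = ennreal (exp (\<Sum>i<N. (h i)\<^sup>2))"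
proof -
  have "(\<integral>\<^sup>+z. (tilt N h z)\<^sup>2 \<partial>white_noise)
      = (\<Prod>i<N. \<integral>\<^sup>+t. ennreal (exp (h i * t - (h i)\<^sup>2 / 2)) ^ 2 \<partial>std_normal_distribution)"
    unfolding white_noise_def tilt_def
    using nn_integral_PiM_prod[where M = "\<lambda>_. std_normal_distribution" and J = "{..<N}"
        and \<psi> = "\<lambda>i t. ennreal (exp (h i * t - (h i)\<^sup>2 / 2)) ^ 2", OF prob_space_std_normal]
    by (simp add: prod_power_distrib)
  also have "\<dots> = (\<Prod>i<N. ennreal (exp ((h i)\<^sup>2)))"
    by (simp only: std_normal_exp_square)
  also have "\<dots> = ennreal (exp (\<Sum>i<N. (h i)\<^sup>2))"
    by (simp add: prod_ennreal exp_sum)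
  finally show ?thesis .
qed

text \<open>
  A likelihood ratio \<open>t\<close> satisfies \<open>t \<le> T + t\<^sup>2 / T\<close>. Integrated over \<open>U\<close>, this bounds the shifted
  probability of \<open>U\<close> by the unshifted one, with an error that is small for large \<open>T\<close> and does not
  depend on \<open>U\<close>.
\<close>

lemma truncated_shift_bound:
  assumes T: "T > 0" and U [measurable]: "U \<in> sets seq_space"
  shows "(\<integral>\<^sup>+z. indicator U (\<lambda>i. z i + truncation N h i) \<partial>white_noise)
     \<le> ennreal T * emeasure white_noise U + ennreal (exp (\<Sum>i<N. (h i)\<^sup>2) / T)"
proof -
  have U' [measurable]: "U \<in> sets white_noise" by simp
  have *: "tilt N h z * indicator U z \<le> ennreal T * indicator U z + ennreal (1 / T) * (tilt N h z)\<^sup>2" for z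
  proof -
    define t where "t = (\<Prod>i<N. exp (h i * z i - (h i)\<^sup>2 / 2))"
    have t: "tilt N h z = ennreal t" "t \<ge> 0"
      by (simp_all add: tilt_def t_def prod_ennreal prod_nonneg)
    have "t \<le> T + 1 / T * t\<^sup>2"
    proof (cases "t \<le> T")
      case True
      then show ?thesis using T by (simp add: add_increasing2)
    next
      case False
      then have "t * T \<le> t * t" using T by (intro mult_left_mono) auto
      then have "t \<le> 1 / T * t\<^sup>2" using T by (simp add: field_simps power2_eq_square)
      then show ?thesis using T by simp
    qed
    then show ?thesis
      using T t by (auto simp: indicator_def ennreal_plus[symmetric] ennreal_mult'[symmetric] ennreal_power
          simp del: ennreal_plus)
  qed
  have "(\<integral>\<^sup>+z. indicator U (\<lambda>i. z i + truncation N h i) \<partial>white_noise)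
     = (\<integral>\<^sup>+z. indicator U z \<partial>distr white_noise seq_space (\<lambda>z i. z i + truncation N h i))"
    by (subst nn_integral_distr) auto
  also have "\<dots> = (\<integral>\<^sup>+z. tilt N h z * indicator U z \<partial>white_noise)"
    unfolding white_noise_truncated_shift by (subst nn_integral_density) auto
  also have "\<dots> \<le> (\<integral>\<^sup>+z. ennreal T * indicator U z + ennreal (1 / T) * (tilt N h z)\<^sup>2 \<partial>white_noise)"
    by (intro nn_integral_mono *)
  also have "\<dots> = ennreal T * emeasure white_noise U + ennreal (1 / T) * ennreal (exp (\<Sum>i<N. (h i)\<^sup>2))"
    by (subst nn_integral_add) (auto simp: nn_integral_cmult nn_integral_tilt_square)
  also have "ennreal (1 / T) * ennreal (exp (\<Sum>i<N. (h i)\<^sup>2)) = ennreal (exp (\<Sum>i<N. (h i)\<^sup>2) / T)"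
    using T by (simp add: ennreal_mult'[symmetric])
  finally show ?thesis .
qed

text \<open>
  The truncated shifts converge pointwise to the full shift, in the product topology. As the
  indicator of an open set is lower semicontinuous, Fatou's lemma carries the bound over.
\<close>

lemma shift_bound_open:
  assumes T: "T > 0" and U: "open U" and h: "summable (\<lambda>i. (h i)\<^sup>2)"
  shows "(\<integral>\<^sup>+z. indicator U (\<lambda>i. z i + h i) \<partial>white_noise)
     \<le> ennreal T * emeasure white_noise U + ennreal (exp (\<Sum>i. (h i)\<^sup>2) / T)"
proof -
  have [measurable]: "U \<in> sets seq_space"
    using U by (simp add: sets_PiM_equal_borel)
  have lim: "(\<lambda>N i. z i + truncation N h i) \<longlonglongrightarrow> (\<lambda>i. z i + h i)" for z
  proof -
    have "limitin (product_topology (\<lambda>i. euclidean) UNIV) (\<lambda>N i. z i + truncation N h i) (\<lambda>i. z i + h i) sequentially"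
      unfolding limitin_componentwise
    proof (intro conjI ballI)
      fix i
      have "eventually (\<lambda>N. z i + truncation N h i = z i + h i) sequentially"
        using eventually_gt_at_top[of i] by eventually_elim (simp add: truncation_def)
      then have "(\<lambda>N. z i + truncation N h i) \<longlonglongrightarrow> z i + h i"
        by (rule tendsto_eventually)
      then show "limitin euclidean (\<lambda>N. z i + truncation N h i) (z i + h i) sequentially"
        by simp
    qed auto
    then show ?thesis by (simp add: euclidean_product_topology)
  qed
  have "indicator U (\<lambda>i. z i + h i) \<le> liminf (\<lambda>N. indicator U (\<lambda>i. z i + truncation N h i) :: ennreal)" for z
  proof (cases "(\<lambda>i. z i + h i) \<in> U")
    case True
    have "eventually (\<lambda>N. (\<lambda>i. z i + truncation N h i) \<in> U) sequentially"
      using topological_tendstoD[OF lim U True] .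
    then have "eventually (\<lambda>N. (1::ennreal) \<le> indicator U (\<lambda>i. z i + truncation N h i)) sequentially"
      by eventually_elim simp
    then show ?thesis using True by (auto intro: Liminf_bounded)
  qed simp
  then have "(\<integral>\<^sup>+z. indicator U (\<lambda>i. z i + h i) \<partial>white_noise)
     \<le> (\<integral>\<^sup>+z. liminf (\<lambda>N. indicator U (\<lambda>i. z i + truncation N h i)) \<partial>white_noise)"
    by (rule nn_integral_mono)
  also have "\<dots> \<le> liminf (\<lambda>N. \<integral>\<^sup>+z. indicator U (\<lambda>i. z i + truncation N h i) \<partial>white_noise)"
    by (rule nn_integral_liminf) measurable
  also have "\<dots> \<le> liminf (\<lambda>N::nat. ennreal T * emeasure white_noise U + ennreal (exp (\<Sum>i. (h i)\<^sup>2) / T))"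
  proof (intro Liminf_mono always_eventually allI)
    fix N
    have "(\<Sum>i<N. (h i)\<^sup>2) \<le> (\<Sum>i. (h i)\<^sup>2)" using h by (intro sum_le_suminf) auto
    then have "ennreal (exp (\<Sum>i<N. (h i)\<^sup>2) / T) \<le> ennreal (exp (\<Sum>i. (h i)\<^sup>2) / T)"
      using T by (intro ennreal_leI divide_right_mono) auto
    then show "(\<integral>\<^sup>+z. indicator U (\<lambda>i. z i + truncation N h i) \<partial>white_noise)
        \<le> ennreal T * emeasure white_noise U + ennreal (exp (\<Sum>i. (h i)\<^sup>2) / T)"
      by (intro order_trans[OF truncated_shift_bound[OF T]] add_left_mono) measurable
  qed
  also have "\<dots> = ennreal T * emeasure white_noise U + ennreal (exp (\<Sum>i. (h i)\<^sup>2) / T)"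
    by (simp add: Liminf_const)
  finally show ?thesis .
qed

text \<open>
  The qualitative half of the Cameron--Martin theorem. By outer regularity the null set lies in an
  open set of arbitrarily small measure, and the bound for open sets applies, first with \<open>T\<close> large
  and then with an open set that is small relative to \<open>T\<close>.
\<close>

proposition white_noise_shift_null:
  assumes A: "A \<in> null_sets white_noise" and h: "summable (\<lambda>i. (h i)\<^sup>2)"
  shows "emeasure white_noise {z. (\<lambda>i. z i + h i) \<in> A} = 0"
proof -
  have A' [measurable]: "A \<in> sets seq_space" using A by (auto simp: sets_white_noise)
  have sp: "space white_noise = UNIV"
    using sets_eq_imp_space_eq[OF sets_white_noise] by (simp add: space_PiM)
  define c where "c = exp (\<Sum>i. (h i)\<^sup>2)"
  have c: "c > 0" by (simp add: c_def)
  interpret prob_space white_noise by (rule prob_space_white_noise)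
  have "emeasure white_noise {z. (\<lambda>i. z i + h i) \<in> A} \<le> 0 + ennreal e" if e: "e > 0" for e
  proof -
    \<comment> \<open>half of \<open>e\<close> goes to \<open>c / T\<close>, the other half to the open set\<close>
    define T where "T = 2 * c / e"
    have T: "T > 0" using c e by (simp add: T_def)
    have "emeasure white_noise A = (INF U \<in> {U. A \<subseteq> U \<and> open U}. emeasure white_noise U)"
      by (rule outer_regular) (auto simp: sets_white_noise sets_PiM_equal_borel A'[unfolded sets_PiM_equal_borel])
    moreover have "emeasure white_noise A = 0" using A by auto
    ultimately have "(INF U \<in> {U. A \<subseteq> U \<and> open U}. emeasure white_noise U) < ennreal (e / 2 / T)"
      using e T by simp
    then obtain U where U: "A \<subseteq> U" "open U" "emeasure white_noise U < ennreal (e / 2 / T)"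
      unfolding INF_less_iff by auto
    have [measurable]: "U \<in> sets seq_space" using U by (simp add: sets_PiM_equal_borel)
    have "emeasure white_noise {z. (\<lambda>i. z i + h i) \<in> A} = (\<integral>\<^sup>+z. indicator A (\<lambda>i. z i + h i) \<partial>white_noise)"
    proof -
      have "{z \<in> space white_noise. (\<lambda>i. z i + h i) \<in> A} \<in> sets white_noise" by measurable
      then have "{z. (\<lambda>i. z i + h i) \<in> A} \<in> sets white_noise" by (simp add: sp)
      then have "emeasure white_noise {z. (\<lambda>i. z i + h i) \<in> A}
          = (\<integral>\<^sup>+z. indicator {z. (\<lambda>i. z i + h i) \<in> A} z \<partial>white_noise)"
        by (rule nn_integral_indicator[symmetric])
      then show ?thesis by (simp add: indicator_def)
    qed
    also have "\<dots> \<le> (\<integral>\<^sup>+z. indicator U (\<lambda>i. z i + h i) \<partial>white_noise)"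
      using U(1) by (intro nn_integral_mono) (auto simp: indicator_def)
    also have "\<dots> \<le> ennreal T * emeasure white_noise U + ennreal (c / T)"
      using shift_bound_open[OF T U(2) h] by (simp add: c_def)
    also have "\<dots> \<le> ennreal T * ennreal (e / 2 / T) + ennreal (c / T)"
      using U(3) by (intro add_right_mono mult_left_mono) auto
    also have "\<dots> = ennreal e"
      using T e c by (simp add: ennreal_mult'[symmetric] ennreal_plus[symmetric] T_def field_simps del: ennreal_plus)
    finally show ?thesis by simp
  qed
  then have "emeasure white_noise {z. (\<lambda>i. z i + h i) \<in> A} \<le> 0"
    by (rule ennreal_le_epsilon)
  then show ?thesis by simp
qed

section \<open>The law of the data under the prior\<close>

lemma sets_gaussian_prior [measurable_cong]: "sets (gaussian_prior v) = sets seq_space"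
  unfolding gaussian_prior_def by (rule sets_PiM_real) (rule sets_centered_normal)

lemma prob_space_gaussian_prior:
  assumes "\<And>i. v i > 0" shows "prob_space (gaussian_prior v)"
  unfolding gaussian_prior_def by (intro prob_space_PiM prob_space_centered_normal assms)

lemma measurable_observe [measurable]: "observe \<kappa> n f \<in> seq_space \<rightarrow>\<^sub>M seq_space"
  unfolding observe_def by (rule measurable_PiM_single') auto

lemma measurable_observe_pair [measurable]:
  "(\<lambda>(f, z). observe \<kappa> n f z) \<in> seq_space \<Otimes>\<^sub>M seq_space \<rightarrow>\<^sub>M seq_space"
  unfolding observe_def split_beta' by (rule measurable_PiM_single') auto

lemma sets_bayes_joint [measurable_cong]: "sets (bayes_joint P \<kappa> n) = sets (seq_space \<Otimes>\<^sub>M seq_space)"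
  by (simp add: bayes_joint_def)

text \<open>
  The law of the data in the Bayesian model. Posteriors are determined only up to null sets of
  this measure.
\<close>

definition obs_marginal :: "(nat \<Rightarrow> real) measure \<Rightarrow> (nat \<Rightarrow> real) \<Rightarrow> nat \<Rightarrow> (nat \<Rightarrow> real) measure" where
  "obs_marginal P \<kappa> n = distr (bayes_joint P \<kappa> n) seq_space snd"

lemma sets_obs_marginal [measurable_cong]: "sets (obs_marginal P \<kappa> n) = sets seq_space"
  by (simp add: obs_marginal_def)

lemma nn_integral_bayes_joint:
  assumes P [measurable_cong]: "sets P = sets seq_space"
    and G [measurable]: "G \<in> borel_measurable (seq_space \<Otimes>\<^sub>M seq_space)"
  shows "(\<integral>\<^sup>+x. G x \<partial>bayes_joint P \<kappa> n) = (\<integral>\<^sup>+f. \<integral>\<^sup>+z. G (f, observe \<kappa> n f z) \<partial>white_noise \<partial>P)"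
proof -
  interpret prob_space white_noise by (rule prob_space_white_noise)
  have [measurable]: "(\<lambda>(f, z). (f, observe \<kappa> n f z)) \<in> P \<Otimes>\<^sub>M white_noise \<rightarrow>\<^sub>M seq_space \<Otimes>\<^sub>M seq_space"
    unfolding split_beta' by (intro measurable_Pair measurable_compose[OF _ measurable_observe_pair, unfolded split_beta']) measurable
  have "(\<integral>\<^sup>+x. G x \<partial>bayes_joint P \<kappa> n) = (\<integral>\<^sup>+x. (case x of (f, z) \<Rightarrow> G (f, observe \<kappa> n f z)) \<partial>(P \<Otimes>\<^sub>M white_noise))"
    unfolding bayes_joint_def by (subst nn_integral_distr) (auto intro!: nn_integral_cong)
  also have "\<dots> = (\<integral>\<^sup>+f. \<integral>\<^sup>+z. G (f, observe \<kappa> n f z) \<partial>white_noise \<partial>P)"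
    by (subst nn_integral_fst[symmetric]) (auto simp: split_beta')
  finally show ?thesis .
qed

lemma nn_integral_obs_marginal:
  assumes P [measurable_cong]: "sets P = sets seq_space"
    and G [measurable]: "G \<in> borel_measurable seq_space"
  shows "(\<integral>\<^sup>+y. G y \<partial>obs_marginal P \<kappa> n) = (\<integral>\<^sup>+f. \<integral>\<^sup>+z. G (observe \<kappa> n f z) \<partial>white_noise \<partial>P)"
proof -
  have "(\<integral>\<^sup>+y. G y \<partial>obs_marginal P \<kappa> n) = (\<integral>\<^sup>+x. G (snd x) \<partial>bayes_joint P \<kappa> n)"
    unfolding obs_marginal_def by (subst nn_integral_distr) auto
  also have "\<dots> = (\<integral>\<^sup>+f. \<integral>\<^sup>+z. G (observe \<kappa> n f z) \<partial>white_noise \<partial>P)"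
    by (subst nn_integral_bayes_joint[OF P]) auto
  finally show ?thesis .
qed

lemma prob_space_obs_marginal:
  assumes "\<And>i. v i > 0"
  shows "prob_space (obs_marginal (gaussian_prior v) \<kappa> n)"
proof -
  interpret P: prob_space "gaussian_prior v" by (rule prob_space_gaussian_prior) (rule assms)
  interpret W: prob_space white_noise by (rule prob_space_white_noise)
  have "(\<integral>\<^sup>+y. 1 \<partial>obs_marginal (gaussian_prior v) \<kappa> n) = 1"
    by (subst nn_integral_obs_marginal) (auto simp: sets_gaussian_prior W.emeasure_space_1 P.emeasure_space_1)
  then show ?thesis by (intro prob_spaceI) simp
qed

lemma centered_normal_second_moment:
  assumes "v > 0"
  shows "(\<integral>\<^sup>+x. ennreal ((x - a)\<^sup>2) \<partial>centered_normal v) = ennreal (a\<^sup>2 + v)"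
  unfolding centered_normal_def
  using normal_second_moment[of "sqrt v" a 0] assms
  by (subst nn_integral_density) (auto simp: mult.commute)

lemma nn_integral_gaussian_prior_component:
  assumes v: "\<And>i. v i > 0" and [measurable]: "g \<in> borel_measurable borel"
  shows "(\<integral>\<^sup>+f. g (f i) \<partial>gaussian_prior v) = (\<integral>\<^sup>+x. g x \<partial>centered_normal (v i))"
proof -
  have [measurable_cong]: "sets (centered_normal (v i)) = sets borel" for i
    by (rule sets_centered_normal)
  have "centered_normal (v i) = distr (gaussian_prior v) (centered_normal (v i)) (\<lambda>f. f i)"
    unfolding gaussian_prior_def
    by (rule distr_PiM_component[symmetric]) (auto intro: prob_space_centered_normal v)
  then have "(\<integral>\<^sup>+x. g x \<partial>centered_normal (v i))
      = (\<integral>\<^sup>+x. g x \<partial>distr (gaussian_prior v) (centered_normal (v i)) (\<lambda>f. f i))"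
    by simp
  also have "\<dots> = (\<integral>\<^sup>+f. g (f i) \<partial>gaussian_prior v)"
    by (rule nn_integral_distr) measurable
  finally show ?thesis ..
qed

lemma AE_gaussian_prior_summable:
  assumes v: "\<And>i. v i > 0" and s: "summable v"
  shows "AE f in gaussian_prior v. summable (\<lambda>i. (f i)\<^sup>2)"
proof -
  have "(\<integral>\<^sup>+f. (\<Sum>i. ennreal ((f i)\<^sup>2)) \<partial>gaussian_prior v) = (\<Sum>i. \<integral>\<^sup>+f. ennreal ((f i)\<^sup>2) \<partial>gaussian_prior v)"
    by (rule nn_integral_suminf) measurable
  also have "\<dots> = (\<Sum>i. ennreal (v i))"
  proof (intro suminf_cong)
    fix i
    show "(\<integral>\<^sup>+f. ennreal ((f i)\<^sup>2) \<partial>gaussian_prior v) = ennreal (v i)"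
      using nn_integral_gaussian_prior_component[where v = v and g = "\<lambda>x. ennreal (x\<^sup>2)" and i = i, OF v]
        centered_normal_second_moment[where v = "v i" and a = 0, OF v(1)] by simp
  qed
  also have "\<dots> = ennreal (\<Sum>i. v i)"
    using v s by (intro suminf_ennreal2) (auto intro: less_imp_le)
  finally have "(\<integral>\<^sup>+f. (\<Sum>i. ennreal ((f i)\<^sup>2)) \<partial>gaussian_prior v) \<noteq> \<infinity>" by simp
  then have "AE f in gaussian_prior v. (\<Sum>i. ennreal ((f i)\<^sup>2)) \<noteq> \<infinity>"
    by (intro nn_integral_noteq_infinite) measurable
  then show ?thesis
    by eventually_elim (auto intro!: summable_suminf_not_top)
qed

text \<open>
  A posterior may be arbitrary on null sets of the marginal law of the data, so its expectation
  under a fixed parameter \<open>f0\<close> is meaningful only because the data law for \<open>f0\<close> is absolutely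
  continuous with respect to that marginal. The reason: the marginal is the mixture over the prior
  of the data laws. If it does not charge \<open>B\<close>, then for prior-almost every \<open>f\<close> the data law of \<open>f\<close>
  does not charge \<open>B\<close> either, and one such \<open>f\<close> is square-summable. The data laws of \<open>f\<close> and \<open>f0\<close>
  differ by a square-summable shift of the noise, which preserves null sets.
\<close>

proposition obs_law_null:
  assumes v: "\<And>i. v i > 0" "summable v" and n: "n \<ge> 1"
    and \<kappa>: "\<And>i. \<bar>\<kappa> i\<bar> \<le> C" and f0: "summable (\<lambda>i. (f0 i)\<^sup>2)"
    and B: "B \<in> null_sets (obs_marginal (gaussian_prior v) \<kappa> n)"
  shows "B \<in> null_sets (obs_law \<kappa> n f0)"
proof -
  let ?P = "gaussian_prior v"
  interpret P: prob_space ?P by (rule prob_space_gaussian_prior) (rule v)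
  have [measurable]: "B \<in> sets seq_space" using B by (auto simp: sets_obs_marginal)
  have spW: "space white_noise = UNIV"
    using sets_eq_imp_space_eq[OF sets_white_noise] by (simp add: space_PiM)
  let ?N = "\<lambda>f. {z \<in> space white_noise. observe \<kappa> n f z \<in> B}"
  have N [measurable]: "?N f \<in> sets white_noise" for f by measurable
  have ind: "(\<integral>\<^sup>+z. indicator B (observe \<kappa> n f z) \<partial>white_noise) = emeasure white_noise (?N f)" for f
  proof -
    have "(\<integral>\<^sup>+z. indicator B (observe \<kappa> n f z) \<partial>white_noise) = (\<integral>\<^sup>+z. indicator (?N f) z \<partial>white_noise)"
      by (intro nn_integral_cong) (simp add: indicator_def)
    then show ?thesis by simp
  qed
  have "0 = (\<integral>\<^sup>+y. indicator B y \<partial>obs_marginal ?P \<kappa> n)"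
    using B by (auto simp: sets_obs_marginal)
  also have "\<dots> = (\<integral>\<^sup>+f. \<integral>\<^sup>+z. indicator B (observe \<kappa> n f z) \<partial>white_noise \<partial>?P)"
    by (rule nn_integral_obs_marginal) (auto simp: sets_gaussian_prior)
  also have "\<dots> = (\<integral>\<^sup>+f. emeasure white_noise (?N f) \<partial>?P)"
    by (simp only: ind)
  finally have "(\<integral>\<^sup>+f. emeasure white_noise (?N f) \<partial>?P) = 0" by simp
  moreover have "(\<lambda>f. emeasure white_noise (?N f)) \<in> borel_measurable ?P"
  proof -
    interpret W: prob_space white_noise by (rule prob_space_white_noise)
    have "(\<lambda>f. \<integral>\<^sup>+z. indicator B (case (f, z) of (f, z) \<Rightarrow> observe \<kappa> n f z) \<partial>white_noise) \<in> borel_measurable ?P"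
      by measurable
    also have "(\<lambda>f. \<integral>\<^sup>+z. indicator B (case (f, z) of (f, z) \<Rightarrow> observe \<kappa> n f z) \<partial>white_noise)
       = (\<lambda>f. emeasure white_noise (?N f))"
      by (simp add: ind)
    finally show ?thesis .
  qed
  ultimately have "AE f in ?P. emeasure white_noise (?N f) = 0"
    by (subst (asm) nn_integral_0_iff_AE) auto
  with AE_gaussian_prior_summable[OF v]
  have "AE f in ?P. summable (\<lambda>i. (f i)\<^sup>2) \<and> emeasure white_noise (?N f) = 0"
    by eventually_elim simp
  then obtain f where f: "summable (\<lambda>i. (f i)\<^sup>2)" "emeasure white_noise (?N f) = 0"
    using eventually_happens'[OF P.ae_filter_bot] by blast
  \<comment> \<open>the noise shift that turns the data for \<open>f\<close> into the data for \<open>f0\<close>\<close>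
  define h where "h i = real n powr (1/2) * (\<kappa> i * (f0 i - f i))" for i
  have "real n powr (-1/2) * real n powr (1/2) = 1"
    using n by (simp add: powr_add[symmetric])
  then have eh: "real n powr (-1/2) * h i = \<kappa> i * (f0 i - f i)" for i
    unfolding h_def mult.assoc[symmetric] by simp
  have shift: "observe \<kappa> n f0 z = observe \<kappa> n f (\<lambda>i. z i + h i)" for z
    unfolding observe_def distrib_left eh by (simp add: right_diff_distrib add.commute)
  have "summable (\<lambda>i. (h i)\<^sup>2)"
  proof (rule summable_comparison_test')
    show "summable (\<lambda>i. real n * C\<^sup>2 * (2 * (f0 i)\<^sup>2 + 2 * (f i)\<^sup>2))"
      using f0 f(1) by (intro summable_mult summable_add)
    fix i
    have "(h i)\<^sup>2 = real n * ((\<kappa> i)\<^sup>2 * (f0 i - f i)\<^sup>2)"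
      using n by (simp add: h_def power_mult_distrib powr_power)
    also have "\<dots> \<le> real n * (C\<^sup>2 * (2 * (f0 i)\<^sup>2 + 2 * (f i)\<^sup>2))"
    proof (intro mult_left_mono mult_mono)
      show "(\<kappa> i)\<^sup>2 \<le> C\<^sup>2" using \<kappa>[of i] by (metis abs_ge_zero power2_abs power_mono)
      have "0 \<le> (f0 i + f i)\<^sup>2" by simp
      then show "(f0 i - f i)\<^sup>2 \<le> 2 * (f0 i)\<^sup>2 + 2 * (f i)\<^sup>2"
        by (simp add: power2_eq_square algebra_simps)
    qed auto
    finally show "norm ((h i)\<^sup>2) \<le> real n * C\<^sup>2 * (2 * (f0 i)\<^sup>2 + 2 * (f i)\<^sup>2)" by simp
  qed
  moreover have "?N f \<in> null_sets white_noise" using f(2) N by auto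
  ultimately have "emeasure white_noise {z. (\<lambda>i. z i + h i) \<in> ?N f} = 0"
    by (intro white_noise_shift_null)
  moreover have "emeasure (obs_law \<kappa> n f0) B = emeasure white_noise (?N f0)"
    unfolding obs_law_def by (subst emeasure_distr) (auto simp: vimage_def Int_def conj_commute)
  ultimately show ?thesis
    by (auto simp: obs_law_def null_sets_def shift spW)
qed

section \<open>Coordinatewise second moments of the posterior\<close>

lemma measurable_posterior:
  "is_posterior P \<kappa> n K \<Longrightarrow> K \<in> seq_space \<rightarrow>\<^sub>M subprob_algebra seq_space"
  unfolding is_posterior_def by (auto dest: measurable_prob_algebraD)

text \<open>
  The defining property of a posterior, extended from sets to nonnegative functions of the
  parameter.
\<close>

lemma posterior_disintegration:
  assumes K: "is_posterior P \<kappa> n K"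
    and B [measurable]: "B \<in> sets seq_space" and g [measurable]: "g \<in> borel_measurable seq_space"
  shows "(\<integral>\<^sup>+y. (\<integral>\<^sup>+f. g f \<partial>K y) * indicator B y \<partial>obs_marginal P \<kappa> n)
       = (\<integral>\<^sup>+x. g (fst x) * indicator B (snd x) \<partial>bayes_joint P \<kappa> n)"
proof -
  have K' [measurable]: "K \<in> seq_space \<rightarrow>\<^sub>M subprob_algebra seq_space"
    by (rule measurable_posterior[OF K])
  define D where "D = density (obs_marginal P \<kappa> n) (indicator B)"
  have [measurable_cong]: "sets D = sets seq_space" by (simp add: D_def sets_obs_marginal)
  have KD: "K \<in> D \<rightarrow>\<^sub>M subprob_algebra seq_space" by measurable
  have spD: "space D \<noteq> {}"
    using sets_eq_imp_space_eq[OF \<open>sets D = sets seq_space\<close>] by (simp add: space_PiM)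
  define J where "J = density (bayes_joint P \<kappa> n) (\<lambda>x. indicator B (snd x))"
  have [measurable_cong]: "sets J = sets (seq_space \<Otimes>\<^sub>M seq_space)" by (simp add: J_def sets_bayes_joint)
  have eq: "D \<bind> K = distr J seq_space fst"
  proof (rule measure_eqI)
    show "sets (D \<bind> K) = sets (distr J seq_space fst)"
      by (simp add: sets_bind_measurable[OF KD spD])
    fix A assume "A \<in> sets (D \<bind> K)"
    then have A [measurable]: "A \<in> sets seq_space" by (simp add: sets_bind_measurable[OF KD spD])
    have "emeasure (D \<bind> K) A = (\<integral>\<^sup>+y. emeasure (K y) A \<partial>D)"
      by (rule emeasure_bind[OF spD KD A])
    also have "\<dots> = (\<integral>\<^sup>+y\<in>B. emeasure (K y) A \<partial>obs_marginal P \<kappa> n)"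
      unfolding D_def by (subst nn_integral_density) (auto simp: mult.commute)
    also have "\<dots> = emeasure (bayes_joint P \<kappa> n) (A \<times> B)"
      using K A B unfolding is_posterior_def obs_marginal_def by simp
    also have "\<dots> = (\<integral>\<^sup>+x. indicator (A \<times> B) x \<partial>bayes_joint P \<kappa> n)" by simp
    also have "\<dots> = (\<integral>\<^sup>+x. indicator B (snd x) * indicator A (fst x) \<partial>bayes_joint P \<kappa> n)"
      by (intro nn_integral_cong) (auto simp: indicator_def split: if_splits)
    also have "\<dots> = (\<integral>\<^sup>+x. indicator A (fst x) \<partial>J)"
      unfolding J_def by (subst nn_integral_density) auto
    also have "\<dots> = (\<integral>\<^sup>+x. indicator A x \<partial>distr J seq_space fst)"
      by (subst nn_integral_distr) auto
    also have "\<dots> = emeasure (distr J seq_space fst) A" by simp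
    finally show "emeasure (D \<bind> K) A = emeasure (distr J seq_space fst) A" .
  qed
  have "(\<integral>\<^sup>+y. (\<integral>\<^sup>+f. g f \<partial>K y) * indicator B y \<partial>obs_marginal P \<kappa> n) = (\<integral>\<^sup>+y. \<integral>\<^sup>+f. g f \<partial>K y \<partial>D)"
    unfolding D_def
    by (subst nn_integral_density)
       (auto simp: mult.commute intro!: measurable_compose[OF K' nn_integral_measurable_subprob_algebra])
  also have "\<dots> = (\<integral>\<^sup>+f. g f \<partial>(D \<bind> K))" by (rule nn_integral_bind[symmetric, OF g KD])
  also have "\<dots> = (\<integral>\<^sup>+x. g (fst x) \<partial>J)" unfolding eq by (subst nn_integral_distr) auto
  also have "\<dots> = (\<integral>\<^sup>+x. g (fst x) * indicator B (snd x) \<partial>bayes_joint P \<kappa> n)"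
    unfolding J_def by (subst nn_integral_density) (auto simp: mult.commute)
  finally show ?thesis .
qed

text \<open>
  On a cylinder set both integrands are products over coordinates, and the two products differ
  only in the factor of index \<open>i\<close>, where the one-dimensional conjugacy identity applies.
\<close>

lemma bayes_second_moment_cylinder:
  fixes v \<kappa> :: "nat \<Rightarrow> real" and A :: "nat \<Rightarrow> real set"
  assumes v: "\<And>i. v i > 0" and n: "n \<ge> 1" and J: "finite J" and A: "\<And>j. j \<in> J \<Longrightarrow> A j \<in> sets borel"
  defines "B \<equiv> prod_emb UNIV (\<lambda>_. borel) J (Pi\<^sub>E J A)"
  shows "(\<integral>\<^sup>+f. \<integral>\<^sup>+z. ennreal ((f i - a)\<^sup>2) * indicator B (observe \<kappa> n f z) \<partial>white_noise \<partial>gaussian_prior v)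
    = (\<integral>\<^sup>+f. \<integral>\<^sup>+z. ennreal (post_risk (v i) (\<kappa> i) (real n powr (-1/2)) a (observe \<kappa> n f z i))
          * indicator B (observe \<kappa> n f z) \<partial>white_noise \<partial>gaussian_prior v)"
proof -
  define e where "e = real n powr (-1/2)"
  have e: "e > 0" using n by (simp add: e_def)
  \<comment> \<open>the coordinate \<open>i\<close> carries the second moment even if the cylinder does not restrict it\<close>
  define L where "L = insert i J"
  have L: "finite L" using J by (simp add: L_def)
  define A' where "A' j = (if j \<in> J then A j else UNIV)" for j
  have A' [measurable]: "A' j \<in> sets borel" for j using A by (auto simp: A'_def)
  have B: "indicator B y = (\<Prod>j\<in>L. indicator (A' j) (y j) :: ennreal)" for y
    unfolding B_def indicator_cylinder[OF J] using L
    by (intro prod.mono_neutral_cong_left) (auto simp: L_def A'_def)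
  have obs: "observe \<kappa> n f z j = \<kappa> j * f j + e * z j" for f z j
    by (simp add: observe_def e_def)
  define \<phi> where "\<phi> q j s t = (if j = i then q s (\<kappa> i * s + e * t) else 1) * indicator (A' j) (\<kappa> j * s + e * t)"
    for q :: "real \<Rightarrow> real \<Rightarrow> ennreal" and j s t
  have prod: "q (f i) (observe \<kappa> n f z i) * indicator B (observe \<kappa> n f z) = (\<Prod>j\<in>L. \<phi> q j (f j) (z j))" for q f z
  proof -
    have "(\<Prod>j\<in>L. \<phi> q j (f j) (z j)) = (\<Prod>j\<in>L. if j = i then q (f i) (\<kappa> i * f i + e * z i) else 1)
        * (\<Prod>j\<in>L. indicator (A' j) (\<kappa> j * f j + e * z j))"
      unfolding prod.distrib[symmetric] by (intro prod.cong refl) (auto simp: \<phi>_def)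
    also have "(\<Prod>j\<in>L. if j = i then q (f i) (\<kappa> i * f i + e * z i) else 1) = q (f i) (\<kappa> i * f i + e * z i)"
      using L by (subst prod.delta) (auto simp: L_def)
    finally show ?thesis by (simp add: B obs)
  qed
  have main: "(\<integral>\<^sup>+f. \<integral>\<^sup>+z. q (f i) (observe \<kappa> n f z i) * indicator B (observe \<kappa> n f z) \<partial>white_noise \<partial>gaussian_prior v)
    = (\<Prod>j\<in>L. \<integral>\<^sup>+s. \<integral>\<^sup>+t. \<phi> q j s t \<partial>std_normal_distribution \<partial>centered_normal (v j))"
    if q [measurable]: "case_prod q \<in> borel_measurable (borel \<Otimes>\<^sub>M borel)" for q
    unfolding prod white_noise_def gaussian_prior_def
  proof (rule nn_integral_PiM_PiM_prod[where M = "\<lambda>j. centered_normal (v j)" and N = "\<lambda>_. std_normal_distribution"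
        and \<phi> = "\<phi> q" and J = L])
    fix j
    have "case_prod (\<phi> q j) \<in> borel_measurable (borel \<Otimes>\<^sub>M borel)"
    proof (cases "j = i")
      case True
      have "(\<lambda>x. case_prod q (fst x, \<kappa> i * fst x + e * snd x)) \<in> borel_measurable (borel \<Otimes>\<^sub>M borel)"
        by measurable
      then show ?thesis using True by (simp add: \<phi>_def split_beta')
    next
      case False
      then show ?thesis by (simp add: \<phi>_def split_beta')
    qed
    then show "case_prod (\<phi> q j) \<in> borel_measurable (borel \<Otimes>\<^sub>M borel)" .
  qed (simp_all add: prob_space_centered_normal v prob_space_std_normal sets_centered_normal L)
  have "(\<integral>\<^sup>+s. \<integral>\<^sup>+t. \<phi> (\<lambda>s y. ennreal ((s - a)\<^sup>2)) j s t \<partial>std_normal_distribution \<partial>centered_normal (v j))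
      = (\<integral>\<^sup>+s. \<integral>\<^sup>+t. \<phi> (\<lambda>s y. ennreal (post_risk (v i) (\<kappa> i) e a y)) j s t \<partial>std_normal_distribution \<partial>centered_normal (v j))" for j
    unfolding \<phi>_def
    using post_risk_conditional_expectation[where l = "v i" and \<epsilon> = e and k = "\<kappa> i" and a = a
        and \<psi> = "indicator (A' i)", OF v e] by (cases "j = i") auto
  then have "(\<Prod>j\<in>L. \<integral>\<^sup>+s. \<integral>\<^sup>+t. \<phi> (\<lambda>s y. ennreal ((s - a)\<^sup>2)) j s t \<partial>std_normal_distribution \<partial>centered_normal (v j))
      = (\<Prod>j\<in>L. \<integral>\<^sup>+s. \<integral>\<^sup>+t. \<phi> (\<lambda>s y. ennreal (post_risk (v i) (\<kappa> i) e a y)) j s t \<partial>std_normal_distribution \<partial>centered_normal (v j))"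
    by (intro prod.cong refl)
  then show ?thesis
    using main[of "\<lambda>s y. ennreal ((s - a)\<^sup>2)"] main[of "\<lambda>s y. ennreal (post_risk (v i) (\<kappa> i) e a y)"]
    unfolding e_def by simp
qed

text \<open>
  Every posterior has the second moments of the explicit Gaussian one, almost surely. Multiplying
  the marginal of the data by either side yields a finite measure; the two measures agree on
  cylinders, hence they are equal, and so are their densities.
\<close>

proposition posterior_second_moment:
  assumes v: "\<And>i. v i > 0" and n: "n \<ge> 1" and K: "is_posterior (gaussian_prior v) \<kappa> n K"
  shows "AE y in obs_marginal (gaussian_prior v) \<kappa> n.
    (\<integral>\<^sup>+f. ennreal ((f i - a)\<^sup>2) \<partial>K y) = ennreal (post_risk (v i) (\<kappa> i) (real n powr (-1/2)) a (y i))"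
proof -
  let ?P = "gaussian_prior v" let ?Q = "obs_marginal ?P \<kappa> n"
  interpret Q: prob_space ?Q by (rule prob_space_obs_marginal) (rule v)
  interpret W: prob_space white_noise by (rule prob_space_white_noise)
  have K' [measurable]: "K \<in> seq_space \<rightarrow>\<^sub>M subprob_algebra seq_space"
    by (rule measurable_posterior[OF K])
  define F where "F y = (\<integral>\<^sup>+f. ennreal ((f i - a)\<^sup>2) \<partial>K y)" for y
  define G where "G y = ennreal (post_risk (v i) (\<kappa> i) (real n powr (-1/2)) a (y i))" for y :: "nat \<Rightarrow> real"
  have F [measurable]: "F \<in> borel_measurable seq_space"
    unfolding F_def by (intro measurable_compose[OF K' nn_integral_measurable_subprob_algebra]) measurable
  have G [measurable]: "G \<in> borel_measurable seq_space"
    unfolding G_def by measurable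
  have Fint: "emeasure (density ?Q F) B
      = (\<integral>\<^sup>+f. \<integral>\<^sup>+z. ennreal ((f i - a)\<^sup>2) * indicator B (observe \<kappa> n f z) \<partial>white_noise \<partial>?P)"
    if [measurable]: "B \<in> sets seq_space" for B
  proof -
    have "emeasure (density ?Q F) B = (\<integral>\<^sup>+y. F y * indicator B y \<partial>?Q)"
      by (subst emeasure_density) (auto simp: sets_obs_marginal)
    also have "\<dots> = (\<integral>\<^sup>+x. ennreal ((fst x i - a)\<^sup>2) * indicator B (snd x) \<partial>bayes_joint ?P \<kappa> n)"
      unfolding F_def by (rule posterior_disintegration[OF K]) measurable
    also have "\<dots> = (\<integral>\<^sup>+f. \<integral>\<^sup>+z. ennreal ((f i - a)\<^sup>2) * indicator B (observe \<kappa> n f z) \<partial>white_noise \<partial>?P)"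
      by (subst nn_integral_bayes_joint) (auto simp: sets_gaussian_prior)
    finally show ?thesis .
  qed
  have Gint: "emeasure (density ?Q G) B
      = (\<integral>\<^sup>+f. \<integral>\<^sup>+z. G (observe \<kappa> n f z) * indicator B (observe \<kappa> n f z) \<partial>white_noise \<partial>?P)"
    if [measurable]: "B \<in> sets seq_space" for B
  proof -
    have "emeasure (density ?Q G) B = (\<integral>\<^sup>+y. G y * indicator B y \<partial>?Q)"
      by (subst emeasure_density) (auto simp: sets_obs_marginal)
    also have "\<dots> = (\<integral>\<^sup>+f. \<integral>\<^sup>+z. G (observe \<kappa> n f z) * indicator B (observe \<kappa> n f z) \<partial>white_noise \<partial>?P)"
      by (subst nn_integral_obs_marginal) (auto simp: sets_gaussian_prior)
    finally show ?thesis .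
  qed
  have "density ?Q F = density ?Q G"
  proof (rule measure_eqI_PiM_infinite[where I = UNIV and M = "\<lambda>_. borel"])
    fix A :: "nat \<Rightarrow> real set" and J :: "nat set"
    assume J: "finite J" and A: "\<And>j. j \<in> J \<Longrightarrow> A j \<in> sets borel"
    have "prod_emb UNIV (\<lambda>_. borel) J (Pi\<^sub>E J A) \<in> sets seq_space"
      using J A by (intro sets_PiM_I) auto
    then show "emeasure (density ?Q F) (prod_emb UNIV (\<lambda>_. borel) J (Pi\<^sub>E J A))
      = emeasure (density ?Q G) (prod_emb UNIV (\<lambda>_. borel) J (Pi\<^sub>E J A))"
      using bayes_second_moment_cylinder[where v = v and \<kappa> = \<kappa> and i = i and a = a, OF v n J A]
      by (simp add: Fint Gint G_def)
  next
    have "UNIV \<in> sets seq_space"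
      using sets.top[of seq_space] by (simp add: space_PiM)
    then have "emeasure (density ?Q F) UNIV = (\<integral>\<^sup>+f. ennreal ((f i - a)\<^sup>2) \<partial>?P)"
      by (simp add: Fint W.emeasure_space_1)
    also have "\<dots> = ennreal (a\<^sup>2 + v i)"
      using nn_integral_gaussian_prior_component[where v = v and g = "\<lambda>x. ennreal ((x - a)\<^sup>2)" and i = i, OF v]
        centered_normal_second_moment[where v = "v i" and a = a, OF v] by simp
    finally show "finite_measure (density ?Q F)"
      by (intro finite_measureI) (simp add: obs_marginal_def space_PiM)
  qed (auto simp: sets_obs_marginal)
  then have "AE y in ?Q. F y = G y"
    by (intro Q.density_unique) (auto simp: measurable_cong_sets[OF sets_obs_marginal refl])
  then show ?thesis by (simp add: F_def G_def)
qed

section \<open>Series that govern the rate\<close>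

lemma suminf_ennreal_le:
  fixes t :: "nat \<Rightarrow> real"
  assumes "\<And>i. t i \<ge> 0" and "\<And>N. (\<Sum>i<N. t i) \<le> X"
  shows "(\<Sum>i. ennreal (t i)) \<le> ennreal X"
  unfolding suminf_eq_SUP
  using assms by (intro SUP_least) (simp add: ennreal_leI)

lemma powr_tail_telescope:
  fixes s x :: real
  assumes s: "s > 0" and x: "x > 0"
  shows "s * (x + 1) powr (- 1 - s) \<le> x powr (- s) - (x + 1) powr (- s)"
proof -
  have "\<exists>z>x. z < x + 1 \<and> (x + 1) powr (- s) - x powr (- s) = (x + 1 - x) * (- s * z powr (- s - 1))"
    using x by (intro MVT2) (auto intro!: derivative_eq_intros)
  then obtain z where z: "x < z" "z < x + 1" "x powr (- s) - (x + 1) powr (- s) = s * z powr (- s - 1)"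
    by (auto simp: algebra_simps)
  have "(x + 1) powr (- s - 1) \<le> z powr (- s - 1)"
    using z x s by (intro powr_mono2') auto
  then show ?thesis using s z(3) by (simp add: minus_diff_commute)
qed

lemma smoothed_tail_sum:
  fixes s k :: real
  assumes s: "s > 0" and k: "k > 0"
  shows "(\<Sum>i<N. (real (Suc i) + k) powr (- 1 - s)) \<le> k powr (- s) / s"
proof -
  have "(\<Sum>i<N. s * (real (Suc i) + k) powr (- 1 - s))
     \<le> (\<Sum>i<N. (real i + k) powr (- s) - (real (Suc i) + k) powr (- s))"
    using powr_tail_telescope[OF s, of "real _ + k"] k
    by (intro sum_mono) (simp add: add_ac)
  also have "\<dots> = k powr (- s) - (real N + k) powr (- s)"
    by (subst sum_lessThan_telescope') simp
  also have "\<dots> \<le> k powr (- s)" by simp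
  finally show ?thesis
    using s by (simp add: sum_distrib_left[symmetric] field_simps)
qed

text \<open>
  The denominator is at least \<open>(k / x)\<^sup>q\<close> and at least \<open>1\<close>, so the left-hand side is at most
  \<open>k\<^sup>-\<^sup>1\<^sup>-\<^sup>2\<^sup>\<alpha>\<close> for \<open>x \<le> k\<close> and at most \<open>x\<^sup>-\<^sup>1\<^sup>-\<^sup>2\<^sup>\<alpha>\<close> for \<open>x > k\<close>. Since \<open>x + k \<le> 2 max x k\<close>, one
  expression in \<open>x + k\<close> bounds both, and its sum telescopes without splitting the series at \<open>k\<close>.
\<close>

lemma posterior_variance_term:
  fixes \<alpha> p k x :: real
  assumes \<alpha>: "\<alpha> > 0" and p: "p \<ge> 0" and k: "k > 0" and x: "x > 0"
  defines "q \<equiv> 1 + 2 * \<alpha> + 2 * p"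
  shows "x powr (- 1 - 2 * \<alpha>) / (1 + k powr q * x powr (- q)) \<le> 2 powr (1 + 2 * \<alpha>) * (x + k) powr (- 1 - 2 * \<alpha>)"
proof -
  have *: "2 powr (1 + 2 * \<alpha>) * (2 * y) powr (- 1 - 2 * \<alpha>) = y powr (- 1 - 2 * \<alpha>)" if "y > 0" for y
    using that by (simp add: powr_mult powr_add[symmetric] mult.assoc[symmetric])
  have mono: "y powr (- 1 - 2 * \<alpha>) \<le> 2 powr (1 + 2 * \<alpha>) * (x + k) powr (- 1 - 2 * \<alpha>)" if "x + k \<le> 2 * y" for y
  proof -
    have "(2 * y) powr (- 1 - 2 * \<alpha>) \<le> (x + k) powr (- 1 - 2 * \<alpha>)"
      using that x k \<alpha> by (intro powr_mono2') auto
    then show ?thesis using *[of y] that x k by (smt (verit) mult_left_mono powr_ge_zero)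
  qed
  have pos: "0 < k powr q * x powr (- q)" using k x by simp
  show ?thesis
  proof (cases "x \<le> k")
    case True
    have "x powr (- 1 - 2 * \<alpha>) / (1 + k powr q * x powr (- q)) \<le> x powr (- 1 - 2 * \<alpha>) / (k powr q * x powr (- q))"
      using pos by (intro divide_left_mono) auto
    also have "\<dots> = x powr (2 * p) * k powr (- q)"
    proof -
      have "x powr (2 * p) * x powr (- q) = x powr (- 1 - 2 * \<alpha>)"
        by (simp add: powr_add[symmetric] q_def algebra_simps)
      moreover have "k powr (- q) * k powr q = 1" using k by (simp add: powr_add[symmetric])
      ultimately show ?thesis using x k pos
        by (simp add: field_simps powr_minus)
    qed
    also have "\<dots> \<le> k powr (2 * p) * k powr (- q)"
      using True x p by (intro mult_right_mono powr_mono2) auto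
    also have "\<dots> = k powr (- 1 - 2 * \<alpha>)"
      by (simp add: powr_add[symmetric] q_def algebra_simps)
    also have "\<dots> \<le> 2 powr (1 + 2 * \<alpha>) * (x + k) powr (- 1 - 2 * \<alpha>)"
      using True by (intro mono) simp
    finally show ?thesis .
  next
    case False
    have "x powr (- 1 - 2 * \<alpha>) / (1 + k powr q * x powr (- q)) \<le> x powr (- 1 - 2 * \<alpha>) / 1"
      using pos by (intro divide_left_mono) auto
    also have "\<dots> \<le> 2 powr (1 + 2 * \<alpha>) * (x + k) powr (- 1 - 2 * \<alpha>)"
      using False by simp (intro mono, simp)
    finally show ?thesis .
  qed
qed

lemma posterior_variance_sum:
  fixes \<alpha> p k :: real
  assumes \<alpha>: "\<alpha> > 0" and p: "p \<ge> 0" and k: "k > 0"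
  defines "q \<equiv> 1 + 2 * \<alpha> + 2 * p"
  shows "(\<Sum>i<N. real (Suc i) powr (- 1 - 2 * \<alpha>) / (1 + k powr q * real (Suc i) powr (- q)))
     \<le> 2 powr (1 + 2 * \<alpha>) / (2 * \<alpha>) * k powr (- 2 * \<alpha>)"
proof -
  have "(\<Sum>i<N. real (Suc i) powr (- 1 - 2 * \<alpha>) / (1 + k powr q * real (Suc i) powr (- q)))
      \<le> (\<Sum>i<N. 2 powr (1 + 2 * \<alpha>) * (real (Suc i) + k) powr (- 1 - 2 * \<alpha>))"
    unfolding q_def by (intro sum_mono posterior_variance_term assms) simp
  also have "\<dots> = 2 powr (1 + 2 * \<alpha>) * (\<Sum>i<N. (real (Suc i) + k) powr (- 1 - 2 * \<alpha>))"
    by (simp only: sum_distrib_left)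
  also have "\<dots> \<le> 2 powr (1 + 2 * \<alpha>) * (k powr (- (2 * \<alpha>)) / (2 * \<alpha>))"
    using smoothed_tail_sum[of "2 * \<alpha>" k N] \<alpha> k by (intro mult_left_mono) auto
  finally show ?thesis by simp
qed

text \<open>
  Interpolation: with \<open>r = (k / x)\<^sup>q\<close> one has \<open>(k / x)\<^sup>2\<^sup>b = r\<^sup>2\<^sup>b\<^sup>/\<^sup>q \<le> (1 + r)\<^sup>2\<close>, because the exponent
  \<open>2 b / q\<close> is at most \<open>2\<close>. Since \<open>x \<ge> 1\<close>, the smoothness \<open>b\<close> may be raised to \<open>\<beta>\<close> in the power
  of \<open>x\<close>, while the rate keeps \<open>b\<close>.
\<close>

lemma squared_bias_term:
  fixes \<beta> b q k x :: real
  assumes q: "q > 0" and b: "0 \<le> b" "b \<le> \<beta>" "b \<le> q" and k: "k > 0" and x: "x \<ge> 1"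
  shows "1 / (1 + k powr q * x powr (- q))\<^sup>2 \<le> x powr (2 * \<beta>) * k powr (- 2 * b)"
proof -
  define r where "r = k powr q * x powr (- q)"
  have r: "r > 0" using k x by (simp add: r_def)
  have "r powr (2 * b / q) = k powr (2 * b) * x powr (- (2 * b))"
    using k x q by (simp add: r_def powr_mult powr_powr)
  moreover have "r powr (2 * b / q) \<le> (1 + r) powr (2 * b / q)"
    using r b q by (intro powr_mono2) auto
  moreover have "(1 + r) powr (2 * b / q) \<le> (1 + r) powr 2"
    using r b q by (intro powr_mono) (auto simp: field_simps)
  moreover have "(1 + r) powr 2 = (1 + r)\<^sup>2" using r by (simp add: powr_numeral)
  ultimately have "k powr (2 * b) * x powr (- (2 * b)) \<le> (1 + r)\<^sup>2" by simp
  then have "1 / (1 + r)\<^sup>2 \<le> 1 / (k powr (2 * b) * x powr (- (2 * b)))"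
    using r k x by (intro divide_left_mono mult_pos_pos) auto
  also have "\<dots> = x powr (2 * b) * k powr (- 2 * b)"
    using k x by (simp add: powr_minus field_simps)
  also have "\<dots> \<le> x powr (2 * \<beta>) * k powr (- 2 * b)"
    using b x by (intro mult_right_mono powr_mono) auto
  finally show ?thesis by (simp add: r_def)
qed

section \<open>Risk of the posterior under a fixed parameter\<close>

lemma nn_integral_obs_law:
  assumes [measurable]: "g \<in> borel_measurable borel"
  shows "(\<integral>\<^sup>+y. g (y i) \<partial>obs_law \<kappa> n f)
       = (\<integral>\<^sup>+t. g (\<kappa> i * f i + real n powr (-1/2) * t) \<partial>std_normal_distribution)"
proof -
  have "(\<integral>\<^sup>+y. g (y i) \<partial>obs_law \<kappa> n f) = (\<integral>\<^sup>+z. g (observe \<kappa> n f z i) \<partial>white_noise)"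
    unfolding obs_law_def by (subst nn_integral_distr) auto
  also have "\<dots> = (\<integral>\<^sup>+z. g (\<kappa> i * f i + real n powr (-1/2) * z i) \<partial>white_noise)"
    by (simp add: observe_def)
  also have "\<dots> = (\<integral>\<^sup>+t. g (\<kappa> i * f i + real n powr (-1/2) * t) \<partial>std_normal_distribution)"
    unfolding white_noise_def
    using nn_integral_PiM_prod[where M = "\<lambda>_. std_normal_distribution" and J = "{i}"
        and \<psi> = "\<lambda>_ t. g (\<kappa> i * f i + real n powr (-1/2) * t)", OF prob_space_std_normal] by simp
  finally show ?thesis .
qed

text \<open>
  Under a fixed parameter \<open>a\<close> the posterior mean has bias \<open>- a / D\<close>, its variance is at most the
  posterior variance \<open>l / D\<close>, and the posterior variance itself contributes the second \<open>l / D\<close>.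
\<close>

lemma frequentist_post_risk:
  fixes l k \<epsilon> a :: real
  assumes l: "l > 0" and k: "k > 0" and e: "\<epsilon> > 0"
  defines "D \<equiv> 1 + l * k\<^sup>2 / \<epsilon>\<^sup>2"
  shows "(\<integral>\<^sup>+t. ennreal (post_risk l k \<epsilon> a (k * a + \<epsilon> * t)) \<partial>std_normal_distribution)
      \<le> ennreal (a\<^sup>2 / D\<^sup>2 + 2 * l / D)"
proof -
  define v where "v = k\<^sup>2 * l + \<epsilon>\<^sup>2"
  have v: "v > 0" unfolding v_def using l e by (simp add: add_nonneg_pos)
  have vD: "v = \<epsilon>\<^sup>2 * D" using e by (simp add: v_def D_def field_simps)
  have D: "D > 0" using l e by (simp add: D_def add_pos_nonneg)
  define m where "m = l * k / v"
  have m: "m > 0" using l k v by (simp add: m_def)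
  \<comment> \<open>\<open>m y - a = m \<epsilon> (t - w)\<close>, so that the risk is a second moment of a standard normal about \<open>w\<close>\<close>
  define w where "w = (a - m * (k * a)) / (m * \<epsilon>)"
  have pr: "post_risk l k \<epsilon> a (k * a + \<epsilon> * t) = (m * \<epsilon>)\<^sup>2 * (t - w)\<^sup>2 + l / D" for t
  proof -
    have "m * (k * a + \<epsilon> * t) - a = (m * \<epsilon>) * (t - w)"
      using m e by (simp add: w_def field_simps)
    then have "(m * (k * a + \<epsilon> * t) - a)\<^sup>2 = (m * \<epsilon>)\<^sup>2 * (t - w)\<^sup>2"
      by (simp add: power_mult_distrib)
    moreover have "l * \<epsilon>\<^sup>2 / v = l / D" using e by (simp add: vD)
    ultimately show ?thesis unfolding post_risk_def v_def[symmetric] m_def[symmetric] by simp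
  qed
  have std: "std_normal_distribution = centered_normal 1" by (simp add: centered_normal_def)
  interpret prob_space std_normal_distribution by (rule prob_space_std_normal)
  have "(\<integral>\<^sup>+t. ennreal (post_risk l k \<epsilon> a (k * a + \<epsilon> * t)) \<partial>std_normal_distribution)
      = (\<integral>\<^sup>+t. ennreal ((m * \<epsilon>)\<^sup>2) * ennreal ((t - w)\<^sup>2) + ennreal (l / D) \<partial>std_normal_distribution)"
    unfolding pr using l D by (intro nn_integral_cong) (simp add: ennreal_mult')
  also have "\<dots> = ennreal ((m * \<epsilon>)\<^sup>2) * (\<integral>\<^sup>+t. ennreal ((t - w)\<^sup>2) \<partial>std_normal_distribution) + ennreal (l / D)"
    using emeasure_space_1 by (subst nn_integral_add) (auto simp: nn_integral_cmult)
  also have "(\<integral>\<^sup>+t. ennreal ((t - w)\<^sup>2) \<partial>std_normal_distribution) = ennreal (w\<^sup>2 + 1)"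
    unfolding std by (rule centered_normal_second_moment) simp
  also have "ennreal ((m * \<epsilon>)\<^sup>2) * ennreal (w\<^sup>2 + 1) + ennreal (l / D) = ennreal ((m * \<epsilon>)\<^sup>2 * (w\<^sup>2 + 1) + l / D)"
    using l D by (simp add: ennreal_mult'[symmetric] ennreal_plus[symmetric] del: ennreal_plus)
  also have "\<dots> \<le> ennreal (a\<^sup>2 / D\<^sup>2 + 2 * l / D)"
  proof (rule ennreal_leI)
    have "m * \<epsilon> * w = a - m * (k * a)" using m e by (simp add: w_def)
    also have "\<dots> = a / D"
    proof -
      have "1 - m * k = (v - l * k\<^sup>2) / v"
        using v by (simp add: m_def diff_divide_distrib power2_eq_square)
      also have "\<dots> = \<epsilon>\<^sup>2 / v" by (simp add: v_def mult.commute)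
      also have "\<dots> = 1 / D" using e by (simp add: vD)
      finally have "1 - m * k = 1 / D" .
      moreover have "a - m * (k * a) = a * (1 - m * k)" by (simp add: right_diff_distrib mult_ac)
      ultimately show ?thesis by simp
    qed
    finally have 1: "(m * \<epsilon>)\<^sup>2 * w\<^sup>2 = a\<^sup>2 / D\<^sup>2"
      by (metis power_mult_distrib power_divide)
    have "(m * \<epsilon>)\<^sup>2 = (l * k\<^sup>2 / v) * (l * \<epsilon>\<^sup>2 / v)"
      by (simp add: m_def power2_eq_square)
    also have "\<dots> \<le> 1 * (l * \<epsilon>\<^sup>2 / v)"
    proof (rule mult_right_mono)
      show "l * k\<^sup>2 / v \<le> 1" using v by (simp add: v_def mult.commute)
    qed (use l v in simp)
    also have "\<dots> = l / D" using e by (simp add: vD)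
    finally show "(m * \<epsilon>)\<^sup>2 * (w\<^sup>2 + 1) + l / D \<le> a\<^sup>2 / D\<^sup>2 + 2 * l / D"
      by (simp add: distrib_left 1)
  qed
  finally show ?thesis .
qed

lemma l2_norm_ge_imp:
  assumes t: "t > 0" and f: "ennreal t \<le> l2_norm f"
  shows "ennreal (t\<^sup>2) \<le> (\<Sum>i. ennreal ((f i)\<^sup>2))"
proof (cases "summable (\<lambda>i. (f i)\<^sup>2)")
  case True
  then have "t \<le> sqrt (\<Sum>i. (f i)\<^sup>2)"
    using f t by (simp add: l2_norm_def ennreal_le_iff2)
  then have "t\<^sup>2 \<le> (\<Sum>i. (f i)\<^sup>2)"
    using t by (metis real_sqrt_le_iff real_sqrt_abs abs_of_pos)
  then show ?thesis using True by (simp add: suminf_ennreal2 ennreal_leI)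
next
  case False
  have "summable (\<lambda>i. (f i)\<^sup>2)" if "(\<Sum>i. ennreal ((f i)\<^sup>2)) \<noteq> top"
    using that by (rule summable_suminf_not_top[rotated]) simp
  with False have "(\<Sum>i. ennreal ((f i)\<^sup>2)) = top" by blast
  then show ?thesis by simp
qed

lemma markov_l2:
  assumes Q: "sets Q = sets seq_space" and t: "t > 0"
  shows "emeasure Q {f. l2_norm (\<lambda>i. f i - f0 i) \<ge> ennreal t}
     \<le> ennreal (1 / t\<^sup>2) * (\<Sum>i. \<integral>\<^sup>+f. ennreal ((f i - f0 i)\<^sup>2) \<partial>Q)"
proof -
  note Q [measurable_cong]
  have sp: "space Q = UNIV" using sets_eq_imp_space_eq[OF Q] by (simp add: space_PiM)
  let ?u = "\<lambda>f. \<Sum>i. ennreal ((f i - f0 i)\<^sup>2)"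
  have inv: "ennreal (1 / t\<^sup>2) * ennreal (t\<^sup>2) = 1"
    using t by (simp add: ennreal_mult'[symmetric])
  have "emeasure Q {f. l2_norm (\<lambda>i. f i - f0 i) \<ge> ennreal t}
     \<le> emeasure Q ({f \<in> UNIV. 1 \<le> ennreal (1 / t\<^sup>2) * ?u f})"
  proof (rule emeasure_mono)
    show "{f. l2_norm (\<lambda>i. f i - f0 i) \<ge> ennreal t} \<subseteq> {f \<in> UNIV. 1 \<le> ennreal (1 / t\<^sup>2) * ?u f}"
      using l2_norm_ge_imp[OF t] mult_left_mono[of "ennreal (t\<^sup>2)" _ "ennreal (1 / t\<^sup>2)"]
      by (auto simp: inv)
    have "{f \<in> space Q. 1 \<le> ennreal (1 / t\<^sup>2) * ?u f} \<in> sets Q" by measurable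
    then show "{f \<in> UNIV. 1 \<le> ennreal (1 / t\<^sup>2) * ?u f} \<in> sets Q" by (simp add: sp)
  qed
  also have "\<dots> \<le> ennreal (1 / t\<^sup>2) * (\<integral>\<^sup>+f. ?u f * indicator UNIV f \<partial>Q)"
    by (rule nn_integral_Markov_inequality[where A = UNIV]) (auto simp: sp[symmetric])
  also have "(\<integral>\<^sup>+f. ?u f * indicator UNIV f \<partial>Q) = (\<Sum>i. \<integral>\<^sup>+f. ennreal ((f i - f0 i)\<^sup>2) \<partial>Q)"
    by (simp add: nn_integral_suminf)
  finally show ?thesis .
qed

lemma sobolev_norm_leD:
  assumes "sobolev_norm \<beta> f \<le> ennreal R" and R: "R > 0"
  shows "summable (\<lambda>i. (f i)\<^sup>2 * real (Suc i) powr (2 * \<beta>))"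
    and "(\<Sum>i. (f i)\<^sup>2 * real (Suc i) powr (2 * \<beta>)) \<le> R\<^sup>2"
proof -
  show s: "summable (\<lambda>i. (f i)\<^sup>2 * real (Suc i) powr (2 * \<beta>))"
    using assms by (auto simp: sobolev_norm_def top_unique split: if_splits)
  then have "sqrt (\<Sum>i. (f i)\<^sup>2 * real (Suc i) powr (2 * \<beta>)) \<le> R"
    using assms by (simp add: sobolev_norm_def)
  then show "(\<Sum>i. (f i)\<^sup>2 * real (Suc i) powr (2 * \<beta>)) \<le> R\<^sup>2"
    using R by (metis real_sqrt_le_iff real_sqrt_abs abs_of_pos)
qed

lemma summable_prior_variances:
  assumes "\<alpha> > 0" shows "summable (\<lambda>i. real (Suc i) powr (- 1 - 2 * \<alpha>))"
  using assms summable_Suc_iff[of "\<lambda>i. real i powr (- 1 - 2 * \<alpha>)"] by (simp add: summable_real_powr_iff)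

text \<open>
  With \<open>\<lambda>\<^sub>i\<close> and \<open>\<kappa>\<^sub>i\<close> of polynomial size, \<open>D\<^sub>i\<close> is at least \<open>C\<^sup>-\<^sup>2 (1 + n i\<^sup>-\<^sup>q)\<close> with
  \<open>q = 1 + 2\<alpha> + 2p\<close>, so the cutoff frequency is \<open>k = n\<^sup>1\<^sup>/\<^sup>q\<close>. The squared bias is of order
  \<open>k\<^sup>-\<^sup>2\<^sup>b\<close> with \<open>b = min \<alpha> \<beta>\<close>, the variances sum to order \<open>k\<^sup>-\<^sup>2\<^sup>\<alpha>\<close>.
\<close>

lemma total_risk_sum:
  fixes \<alpha> \<beta> p C R :: real and f0 \<kappa> :: "nat \<Rightarrow> real"
  assumes p: "p \<ge> 0" and C: "C \<ge> 1" and \<kappa>: "\<And>i. inverse C * real (Suc i) powr (- p) \<le> \<kappa> i"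
    and \<alpha>: "\<alpha> > 0" and \<beta>: "\<beta> > 0" and R: "R > 0" and n: "n \<ge> 1"
    and f0: "sobolev_norm \<beta> f0 \<le> ennreal R"
  defines "q \<equiv> 1 + 2 * \<alpha> + 2 * p" and "b \<equiv> min \<alpha> \<beta>"
    and "l \<equiv> \<lambda>i. real (Suc i) powr (- 1 - 2 * \<alpha>)"
  defines "D \<equiv> \<lambda>i. 1 + l i * (\<kappa> i)\<^sup>2 / (real n powr (-1/2))\<^sup>2"
  shows "(\<Sum>i. ennreal ((f0 i)\<^sup>2 / (D i)\<^sup>2 + 2 * l i / D i))
    \<le> ennreal ((C ^ 4 * R\<^sup>2 + 2 * C\<^sup>2 * (2 powr (1 + 2 * \<alpha>) / (2 * \<alpha>))) * (real n powr (- (b / q)))\<^sup>2)"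
proof (rule suminf_ennreal_le)
  define k where "k = real n powr (1 / q)"
  have q: "q > 0" using \<alpha> p by (simp add: q_def)
  have k: "k > 0" "k \<ge> 1" "k powr q = real n"
    using n q by (simp_all add: k_def powr_powr ge_one_powr_ge_zero)
  have kb: "k powr (- 2 * b) = (real n powr (- (b / q)))\<^sup>2"
    using n by (simp add: k_def powr_powr powr_power field_simps)
  have n2: "(real n powr (-1/2))\<^sup>2 = 1 / real n"
  proof -
    have "(real n powr (-1/2))\<^sup>2 = real n powr (-1/2 + -1/2)"
      by (simp only: power2_eq_square powr_add)
    then show ?thesis using n by (simp add: powr_minus_divide)
  qed
  define E where "E i = 1 + real n * real (Suc i) powr (- q)" for i
  have b\<alpha>: "b \<le> \<alpha>" by (simp add: b_def)
  have E: "E i \<ge> 1" for i by (simp add: E_def)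
  have l: "l i > 0" for i by (simp add: l_def)
  have DE: "E i / C\<^sup>2 \<le> D i" for i
  proof -
    have "(inverse C * real (Suc i) powr (- p))\<^sup>2 \<le> (\<kappa> i)\<^sup>2"
      using \<kappa>[of i] C by (intro power_mono) auto
    moreover have "(inverse C * real (Suc i) powr (- p))\<^sup>2 = real (Suc i) powr (- 2 * p) / C\<^sup>2"
      by (simp add: power_mult_distrib powr_power divide_inverse power_inverse mult.commute)
    ultimately have "real n * (l i * (real (Suc i) powr (- 2 * p) / C\<^sup>2)) \<le> real n * (l i * (\<kappa> i)\<^sup>2)"
      using l[of i] by (intro mult_left_mono) auto
    moreover have "l i * real (Suc i) powr (- 2 * p) = real (Suc i) powr (- q)"
      by (simp add: l_def q_def powr_add[symmetric] algebra_simps)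
    ultimately have "real n * real (Suc i) powr (- q) / C\<^sup>2 \<le> real n * (l i * (\<kappa> i)\<^sup>2)" by simp
    moreover have "1 / C\<^sup>2 \<le> 1" using C by (simp add: power2_eq_square mult_ge1_I)
    ultimately show ?thesis unfolding D_def E_def n2 by (simp add: add_divide_distrib mult_ac)
  qed
  have Dpos: "D i > 0" for i
    using DE[of i] E[of i] C by (smt (verit) divide_pos_pos zero_less_power)
  show "0 \<le> (f0 i)\<^sup>2 / (D i)\<^sup>2 + 2 * l i / D i" for i
    using l[of i] Dpos[of i] by simp
  have invD: "1 / D i \<le> C\<^sup>2 / E i" for i
  proof -
    have "1 / D i \<le> 1 / (E i / C\<^sup>2)"
      using DE[of i] E[of i] C by (intro divide_left_mono mult_pos_pos Dpos divide_pos_pos) auto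
    then show ?thesis by simp
  qed
  have bias: "(f0 i)\<^sup>2 / (D i)\<^sup>2 \<le> C ^ 4 * k powr (- 2 * b) * ((f0 i)\<^sup>2 * real (Suc i) powr (2 * \<beta>))" for i
  proof -
    have "(1 / D i)\<^sup>2 \<le> (C\<^sup>2 / E i)\<^sup>2"
      using invD[of i] Dpos[of i] by (intro power_mono) auto
    also have "\<dots> = C ^ 4 * (1 / (E i)\<^sup>2)" by (simp add: power_divide)
    also have "1 / (E i)\<^sup>2 \<le> real (Suc i) powr (2 * \<beta>) * k powr (- 2 * b)"
      unfolding E_def k(3)[symmetric]
      using \<alpha> \<beta> p k by (intro squared_bias_term) (auto simp: b_def q_def)
    finally have "1 / (D i)\<^sup>2 \<le> C ^ 4 * (real (Suc i) powr (2 * \<beta>) * k powr (- 2 * b))"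
      using C by (simp add: power_divide)
    then have "(f0 i)\<^sup>2 * (1 / (D i)\<^sup>2) \<le> (f0 i)\<^sup>2 * (C ^ 4 * (real (Suc i) powr (2 * \<beta>) * k powr (- 2 * b)))"
      by (rule mult_left_mono) simp
    then show ?thesis by (simp add: mult_ac)
  qed
  have var: "2 * l i / D i \<le> 2 * C\<^sup>2 * (l i / E i)" for i
    using mult_left_mono[OF invD[of i], of "2 * l i"] l[of i] by (simp add: mult_ac)
  fix N
  have "(\<Sum>i<N. (f0 i)\<^sup>2 / (D i)\<^sup>2 + 2 * l i / D i)
      \<le> (\<Sum>i<N. C ^ 4 * k powr (- 2 * b) * ((f0 i)\<^sup>2 * real (Suc i) powr (2 * \<beta>)) + 2 * C\<^sup>2 * (l i / E i))"
    by (intro sum_mono add_mono bias var)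
  also have "\<dots> = C ^ 4 * k powr (- 2 * b) * (\<Sum>i<N. (f0 i)\<^sup>2 * real (Suc i) powr (2 * \<beta>))
      + 2 * C\<^sup>2 * (\<Sum>i<N. l i / E i)"
    by (simp only: sum.distrib sum_distrib_left)
  also have "\<dots> \<le> C ^ 4 * k powr (- 2 * b) * R\<^sup>2
      + 2 * C\<^sup>2 * (2 powr (1 + 2 * \<alpha>) / (2 * \<alpha>) * k powr (- 2 * b))"
  proof (intro add_mono mult_left_mono)
    have "(\<Sum>i<N. (f0 i)\<^sup>2 * real (Suc i) powr (2 * \<beta>)) \<le> (\<Sum>i. (f0 i)\<^sup>2 * real (Suc i) powr (2 * \<beta>))"
      by (intro sum_le_suminf sobolev_norm_leD(1)[OF f0 R]) auto
    then show "(\<Sum>i<N. (f0 i)\<^sup>2 * real (Suc i) powr (2 * \<beta>)) \<le> R\<^sup>2"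
      using sobolev_norm_leD(2)[OF f0 R] by simp
    have "(\<Sum>i<N. l i / E i) \<le> 2 powr (1 + 2 * \<alpha>) / (2 * \<alpha>) * k powr (- 2 * \<alpha>)"
      unfolding l_def E_def k(3)[symmetric] q_def by (rule posterior_variance_sum[OF \<alpha> p k(1)])
    also have "\<dots> \<le> 2 powr (1 + 2 * \<alpha>) / (2 * \<alpha>) * k powr (- 2 * b)"
      using \<alpha> k b\<alpha> by (intro mult_left_mono[OF powr_mono]) auto
    finally show "(\<Sum>i<N. l i / E i) \<le> 2 powr (1 + 2 * \<alpha>) / (2 * \<alpha>) * k powr (- 2 * b)" .
  qed (use C in auto)
  also have "\<dots> = (C ^ 4 * R\<^sup>2 + 2 * C\<^sup>2 * (2 powr (1 + 2 * \<alpha>) / (2 * \<alpha>))) * (real n powr (- (b / q)))\<^sup>2"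
    unfolding kb by (subst distrib_right) (simp only: mult_ac)
  finally show "(\<Sum>i<N. (f0 i)\<^sup>2 / (D i)\<^sup>2 + 2 * l i / D i) \<le> \<dots>" .
qed

text \<open>
  Markov's inequality for the posterior bounds the mass outside the ball by the total posterior
  second moment about \<open>f0\<close>, whose almost sure value is known, and remains so under the data law of
  \<open>f0\<close>. The bound is uniform over the Sobolev ball.
\<close>

proposition posterior_mass_bound:
  fixes p C \<alpha> \<beta> R t :: real
    and \<kappa> f0 :: "nat \<Rightarrow> real"
  assumes p: "p \<ge> 0" and C: "C \<ge> 1"
    and \<kappa>: "\<And>i. inverse C * real (Suc i) powr (- p) \<le> \<kappa> i"
    and \<kappa>': "\<And>i. \<kappa> i \<le> C * real (Suc i) powr (- p)"
    and \<alpha>: "\<alpha> > 0" and \<beta>: "\<beta> > 0" and R: "R > 0" and n: "n \<ge> 1"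
    and K: "is_posterior (gaussian_prior (\<lambda>i. real (Suc i) powr (- 1 - 2 * \<alpha>))) \<kappa> n K"
    and f0: "f0 \<in> ell2" "sobolev_norm \<beta> f0 \<le> ennreal R" and t: "t > 0"
  shows "(\<integral>\<^sup>+ y. emeasure (K y)
                 {f. l2_norm (\<lambda>i. f i - f0 i) \<ge>
                       ennreal (t * real n powr (- (min \<alpha> \<beta> / (1 + 2 * \<alpha> + 2 * p))))}
               \<partial>obs_law \<kappa> n f0)
     \<le> ennreal ((C ^ 4 * R\<^sup>2 + 2 * C\<^sup>2 * (2 powr (1 + 2 * \<alpha>) / (2 * \<alpha>))) / t\<^sup>2)"
proof -
  define l where "l i = real (Suc i) powr (- 1 - 2 * \<alpha>)" for i
  define e where "e = real n powr (-1/2)"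
  define r where "r = real n powr (- (min \<alpha> \<beta> / (1 + 2 * \<alpha> + 2 * p)))"
  define H where "H = C ^ 4 * R\<^sup>2 + 2 * C\<^sup>2 * (2 powr (1 + 2 * \<alpha>) / (2 * \<alpha>))"
  have e: "e > 0" and r: "r > 0" using n by (simp_all add: e_def r_def)
  have l: "l i > 0" for i by (simp add: l_def)
  have \<kappa>pos: "\<kappa> i > 0" for i
    using \<kappa>[of i] C by (smt (verit) mult_pos_pos positive_imp_inverse_positive powr_gt_zero of_nat_0_less_iff zero_less_Suc of_nat_eq_0_iff nat.distinct(1))
  have K: "is_posterior (gaussian_prior l) \<kappa> n K" using K by (simp add: l_def[abs_def])
  have K' [measurable]: "K \<in> seq_space \<rightarrow>\<^sub>M subprob_algebra seq_space"
    by (rule measurable_posterior[OF K])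
  let ?O = "obs_law \<kappa> n f0"
  have sO [measurable_cong]: "sets ?O = sets seq_space" by (simp add: obs_law_def)
  have spO: "space ?O = UNIV" by (simp add: obs_law_def space_PiM)
  have "\<bar>\<kappa> i\<bar> \<le> C" for i
  proof -
    have "real (Suc i) powr (- p) \<le> real (Suc i) powr 0"
      using p by (intro powr_mono) auto
    then have "C * real (Suc i) powr (- p) \<le> C * 1"
      using C by (intro mult_left_mono) auto
    then show ?thesis using \<kappa>'[of i] \<kappa>pos[of i] by simp
  qed
  moreover have "summable (\<lambda>i. (f0 i)\<^sup>2)"
    using f0(1) by (auto simp: ell2_def l2_norm_def split: if_splits)
  moreover have "summable l" unfolding l_def[abs_def] by (rule summable_prior_variances[OF \<alpha>])
  ultimately have null: "B \<in> null_sets ?O" if "B \<in> null_sets (obs_marginal (gaussian_prior l) \<kappa> n)" for B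
    using obs_law_null[where v = l, OF l _ n _ _ that] by blast
  have "AE y in obs_marginal (gaussian_prior l) \<kappa> n.
      \<forall>i. (\<integral>\<^sup>+f. ennreal ((f i - f0 i)\<^sup>2) \<partial>K y) = ennreal (post_risk (l i) (\<kappa> i) e (f0 i) (y i))"
    unfolding AE_all_countable e_def by (intro allI posterior_second_moment l n K)
  then obtain B where "B \<in> null_sets (obs_marginal (gaussian_prior l) \<kappa> n)"
    and B: "{y \<in> space (obs_marginal (gaussian_prior l) \<kappa> n). \<not> (\<forall>i. (\<integral>\<^sup>+f. ennreal ((f i - f0 i)\<^sup>2) \<partial>K y) = ennreal (post_risk (l i) (\<kappa> i) e (f0 i) (y i)))} \<subseteq> B"
    unfolding eventually_ae_filter by blast
  then have AE: "AE y in ?O. \<forall>i. (\<integral>\<^sup>+f. ennreal ((f i - f0 i)\<^sup>2) \<partial>K y) = ennreal (post_risk (l i) (\<kappa> i) e (f0 i) (y i))"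
    unfolding eventually_ae_filter by (intro bexI[of _ B] null) (auto simp: obs_marginal_def space_PiM spO)
  have tr: "t * r > 0" using t r by simp
  have "(\<integral>\<^sup>+ y. emeasure (K y) {f. l2_norm (\<lambda>i. f i - f0 i) \<ge> ennreal (t * r)} \<partial>?O)
      \<le> (\<integral>\<^sup>+ y. ennreal (1 / (t * r)\<^sup>2) * (\<Sum>i. \<integral>\<^sup>+f. ennreal ((f i - f0 i)\<^sup>2) \<partial>K y) \<partial>?O)"
    using sets_kernel[OF K'] by (intro nn_integral_mono markov_l2 tr) (auto simp: space_PiM)
  also have "\<dots> = (\<integral>\<^sup>+ y. ennreal (1 / (t * r)\<^sup>2) * (\<Sum>i. ennreal (post_risk (l i) (\<kappa> i) e (f0 i) (y i))) \<partial>?O)"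
    using AE by (intro nn_integral_cong_AE) (auto elim!: eventually_mono)
  also have "\<dots> = ennreal (1 / (t * r)\<^sup>2) * (\<Sum>i. \<integral>\<^sup>+ y. ennreal (post_risk (l i) (\<kappa> i) e (f0 i) (y i)) \<partial>?O)"
    by (simp add: nn_integral_cmult nn_integral_suminf)
  also have "\<dots> \<le> ennreal (1 / (t * r)\<^sup>2) * (\<Sum>i. ennreal ((f0 i)\<^sup>2 / (1 + l i * (\<kappa> i)\<^sup>2 / e\<^sup>2)\<^sup>2 + 2 * l i / (1 + l i * (\<kappa> i)\<^sup>2 / e\<^sup>2)))"
  proof (intro mult_left_mono suminf_le)
    fix i
    have "(\<integral>\<^sup>+ y. ennreal (post_risk (l i) (\<kappa> i) e (f0 i) (y i)) \<partial>?O)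
        = (\<integral>\<^sup>+t. ennreal (post_risk (l i) (\<kappa> i) e (f0 i) (\<kappa> i * f0 i + e * t)) \<partial>std_normal_distribution)"
      unfolding e_def by (rule nn_integral_obs_law) measurable
    also have "\<dots> \<le> ennreal ((f0 i)\<^sup>2 / (1 + l i * (\<kappa> i)\<^sup>2 / e\<^sup>2)\<^sup>2 + 2 * l i / (1 + l i * (\<kappa> i)\<^sup>2 / e\<^sup>2))"
      by (rule frequentist_post_risk[OF l \<kappa>pos e])
    finally show "(\<integral>\<^sup>+ y. ennreal (post_risk (l i) (\<kappa> i) e (f0 i) (y i)) \<partial>?O) \<le> \<dots>" .
  qed auto
  also have "\<dots> \<le> ennreal (1 / (t * r)\<^sup>2) * ennreal (H * r\<^sup>2)"
    unfolding e_def l_def H_def r_def by (intro mult_left_mono total_risk_sum p C \<kappa> \<alpha> \<beta> R n f0(2)) auto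
  also have "\<dots> = ennreal (H / t\<^sup>2)"
    using t r by (simp add: ennreal_mult'[symmetric] power_mult_distrib)
  finally show ?thesis unfolding r_def H_def .
qed

section \<open>Contraction\<close>

theorem theorem3p1:
  fixes p C \<alpha> \<beta> R :: real
    and \<kappa> :: "nat \<Rightarrow> real"
    and M :: "nat \<Rightarrow> real"
    and Post :: "nat \<Rightarrow> (nat \<Rightarrow> real) \<Rightarrow> (nat \<Rightarrow> real) measure"
  assumes "p \<ge> 0" and "C \<ge> 1"
    and "\<And>i. inverse C * real (Suc i) powr (- p) \<le> \<kappa> i"
    and "\<And>i. \<kappa> i \<le> C * real (Suc i) powr (- p)"
    and "\<alpha> > 0" and "\<beta> > 0" and "R > 0"
    and "filterlim M at_top sequentially"
    and "\<And>n. n \<ge> 1 \<Longrightarrow>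
           is_posterior (gaussian_prior (\<lambda>i. real (Suc i) powr (- 1 - 2 * \<alpha>))) \<kappa> n (Post n)"
  shows "(\<lambda>n. SUP f0 \<in> {f \<in> sobolev_space \<beta>. sobolev_norm \<beta> f \<le> ennreal R}.
            \<integral>\<^sup>+ y. emeasure (Post n y)
                 {f. l2_norm (\<lambda>i. f i - f0 i) \<ge>
                       ennreal (M n * real n powr (- (min \<alpha> \<beta> / (1 + 2 * \<alpha> + 2 * p))))}
               \<partial>obs_law \<kappa> n f0)
         \<longlonglongrightarrow> 0"
proof -
  define H where "H = C ^ 4 * R\<^sup>2 + 2 * C\<^sup>2 * (2 powr (1 + 2 * \<alpha>) / (2 * \<alpha>))"
  have "((\<lambda>x. H / x\<^sup>2) \<longlongrightarrow> 0) at_top"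
    by (intro tendsto_divide_0[OF tendsto_const] filterlim_at_top_imp_at_infinity filterlim_pow_at_top filterlim_ident) simp
  then have "(\<lambda>n. H / (M n)\<^sup>2) \<longlonglongrightarrow> 0"
    using assms(8) by (rule filterlim_compose)
  then have upper: "(\<lambda>n. ennreal (H / (M n)\<^sup>2)) \<longlonglongrightarrow> 0"
    using tendsto_ennrealI by fastforce
  have "eventually (\<lambda>n. M n > 0) sequentially"
    using assms(8) by (simp add: filterlim_at_top_dense)
  then have "eventually (\<lambda>n. (SUP f0 \<in> {f \<in> sobolev_space \<beta>. sobolev_norm \<beta> f \<le> ennreal R}.
            \<integral>\<^sup>+ y. emeasure (Post n y)
                 {f. l2_norm (\<lambda>i. f i - f0 i) \<ge>
                       ennreal (M n * real n powr (- (min \<alpha> \<beta> / (1 + 2 * \<alpha> + 2 * p))))}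
               \<partial>obs_law \<kappa> n f0) \<le> ennreal (H / (M n)\<^sup>2)) sequentially"
    using eventually_ge_at_top[of 1]
  proof eventually_elim
    case (elim n)
    show ?case
      unfolding H_def
      using elim by (intro SUP_least posterior_mass_bound assms) (auto simp: sobolev_space_def)
  qed
  then show ?thesis
    by (intro tendsto_sandwich[OF _ _ tendsto_const upper]) auto
qed

end
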